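(* Let $X$ be a nonempty set, $t\in X$, $a,d\in\mathbb Z$, and let $C_n(X)=\mathbb ZX^{n+1}$ ($n\ge0$) with boundary $\partial^{(a,d)}=a\,\partial^{( *_0)}+d\,\partial^{( *_\sim)}$, where $x*_0y=x$ and $x*_\sim y=y$. (1) The chain complex $(C_n(X),\partial^{(a,d)})$ splits as a direct sum of three chain complexes: (i) $C_n(\{t\})$, the chain complex of the point $t$; (ii) the reduced early degenerate complex $F_0(X,\{t\})$; (iii) the reduced early normalized complex $C^{eN}_n(X,\{t\})$. (2) If $a+d\ne0$, then $H_n(\{t\})$ is $\mathbb Z$ for $n=0$, $0$ for $n>0$ even, and $\mathbb Z_{a+d}$ for $n$ odd. If $a+d=0$, then $H_n(\{t\})=\mathbb Z$ for all $n\ge0$. (3) If $X$ is finite and $a$ or $d$ is different from $0$, then $H_n(F_0(X,\{t\}))$ is $\mathbb Z_{\gcd(a,d)}^{u_n-1}$ if $n$ is even and $\mathbb Z_{\gcd(a,d)}^{u_n}$ if $n$ is odd, where $u_0=1$, $u_1=|X|-1$ and $u_n+u_{n-1}=|X|^n$, that is $u_n=|X|^n-|X|^{n-1}+\dots+(-1)^n=\frac{|X|^{n+1}+(-1)^n}{|X|+1}$. (4) If $X$ is finite and $a\ne0$, then $H_n(C^{eN}(X,\{t\}))\cong\mathbb Z_a^{u_{n+1}-u_n+(-1)^n}$. (5) If $X$ is finite, $a\ne0$ and $a+d\ne0$, then $$H_n(X)\cong\begin{cases}\mathbb Z\oplus\mathbb Z_a^{|X|-1}& n=0,\\ \mathbb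 Z_a^{u_{n+1}-u_n+1}\oplus\mathbb Z_{\gcd(a,d)}^{u_n-1}& n>0\text{ even},\\ \mathbb Z_{a+d}\oplus\mathbb Z_a^{u_{n+1}-u_n-1}\oplus\mathbb Z_{\gcd(a,d)}^{u_n}& n\text{ odd}.\end{cases}$$
   Context: For a binary operation $*$ on $X$, $\partial_n^{( * )}:\mathbb ZX^{n+1}\to\mathbb ZX^n$ ($n\ge1$) is $\partial_n^{( * )}(x_0,\dots,x_n)=(x_1,\dots,x_n)+\sum_{i=1}^n(-1)^i(x_0*x_i,\dots,x_{i-1}*x_i,x_{i+1},\dots,x_n)$; complexes are not augmented ($C_n=0$ for $n<0$). $H_n(X)$ is the homology of $(C_n(X),\partial^{(a,d)})$. $C_n(\{t\})$ is the subcomplex spanned by $(t,\dots,t)\in X^{n+1}$, with homology $H_n(\{t\})$, and $C_n(X,\{t\})=C_n(X)/C_n(\{t\})$. Let $s_0(x_0,\dots,x_n)=(x_0,x_0,x_1,\dots,x_n)$ and $F^0_n=s_0C_{n-1}(X)$ ($F^0_0=0$), a subcomplex of $C_n(X)$. The reduced early degenerate complex $F_0(X,\{t\})$ is the image of $F^0$ in $C(X,\{t\})$, i.e. $F^0_n/C_n(\{t\})$ for $n\ge1$ and $0$ for $n=0$. The reduced early normalized complex is $C_n^{eN}(X,\{t\})=C_n(X,\{t\})/F_0(X,\{t\})_n$. $\mathbb Z_m=\mathbb Z/m\mathbb Z$. *)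

theory Defs
  imports "HOL-Algebra.Free_Abelian_Groups"
begin

section \<open>Chain complexes of abelian groups\<close>

text \<open>
  A complex in degrees \<open>n \<ge> 0\<close>: \<open>Ch C n\<close> is the group of \<open>n\<close>-chains and
  \<open>Bd C n\<close> is the boundary map \<open>\<partial>\<^sub>n\<close> from degree \<open>n\<close> to degree \<open>n - 1\<close>, for \<open>n \<ge> 1\<close>.
  Complexes are not augmented; the value of \<open>Bd C 0\<close> is never used.
\<close>

record 'g cplx =
  Ch :: "nat \<Rightarrow> 'g monoid"
  Bd :: "nat \<Rightarrow> 'g \<Rightarrow> 'g"

definition chain_complex :: "'g cplx \<Rightarrow> bool" where
  "chain_complex C \<longleftrightarrow>
     (\<forall>n. comm_group (Ch C n)) \<and>
     (\<forall>n. Bd C (Suc n) \<in> hom (Ch C (Suc n)) (Ch C n)) \<and>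
     (\<forall>n. \<forall>c \<in> carrier (Ch C (Suc (Suc n))).
        Bd C (Suc n) (Bd C (Suc (Suc n)) c) = \<one>\<^bsub>Ch C n\<^esub>)"

text \<open>Since \<open>C\<^bsub>-1\<^esub> = 0\<close>, every 0-chain is a cycle.\<close>

definition cycles :: "'g cplx \<Rightarrow> nat \<Rightarrow> 'g set" where
  "cycles C n = (if n = 0 then carrier (Ch C 0) else kernel (Ch C n) (Ch C (n - 1)) (Bd C n))"

definition boundaries :: "'g cplx \<Rightarrow> nat \<Rightarrow> 'g set" where
  "boundaries C n = Bd C (Suc n) ` carrier (Ch C (Suc n))"

definition homology :: "'g cplx \<Rightarrow> nat \<Rightarrow> 'g set monoid" where
  "homology C n = (Ch C n)\<lparr>carrier := cycles C n\<rparr> Mod boundaries C n"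

definition quot_proj :: "'g cplx \<Rightarrow> 'g cplx \<Rightarrow> nat \<Rightarrow> 'g \<Rightarrow> 'g set" where
  "quot_proj C S n c = carrier (Ch S n) #>\<^bsub>Ch C n\<^esub> c"

text \<open>The quotient of \<open>C\<close> by a subcomplex \<open>S\<close>, with the induced boundary on cosets:
  the coset of \<open>c\<close> is sent to the coset of \<open>\<partial>\<^sub>n c\<close>.\<close>

definition quot_cplx :: "'g cplx \<Rightarrow> 'g cplx \<Rightarrow> 'g set cplx" where
  "quot_cplx C S =
     \<lparr>Ch = (\<lambda>n. Ch C n Mod carrier (Ch S n)),
      Bd = (\<lambda>n A. the_elem ((\<lambda>c. quot_proj C S (n - 1) (Bd C n c)) ` A))\<rparr>"

definition sum_cplx :: "'g cplx \<Rightarrow> 'h cplx \<Rightarrow> ('g \<times> 'h) cplx" where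
  "sum_cplx C D =
     \<lparr>Ch = (\<lambda>n. Ch C n \<times>\<times> Ch D n), Bd = (\<lambda>n. map_prod (Bd C n) (Bd D n))\<rparr>"

definition chain_iso :: "'g cplx \<Rightarrow> 'h cplx \<Rightarrow> (nat \<Rightarrow> 'g \<Rightarrow> 'h) \<Rightarrow> bool" where
  "chain_iso C D \<Phi> \<longleftrightarrow>
     (\<forall>n. \<Phi> n \<in> iso (Ch C n) (Ch D n)) \<and>
     (\<forall>n. \<forall>c \<in> carrier (Ch C (Suc n)). \<Phi> n (Bd C (Suc n) c) = Bd D (Suc n) (\<Phi> (Suc n) c))"


section \<open>The complex of the operations \<open>*\<^sub>0\<close> and \<open>*\<^sub>\<sim>\<close>\<close>

text \<open>The tuple \<open>(x\<^sub>0, \<dots>, x\<^sub>n)\<close> is the list of its \<open>n + 1\<close> entries.\<close>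

definition tuples :: "'a set \<Rightarrow> nat \<Rightarrow> 'a list set" where
  "tuples X n = {xs. length xs = Suc n \<and> set xs \<subseteq> X}"

definition op_zero :: "'a \<Rightarrow> 'a \<Rightarrow> 'a" where
  "op_zero x y = x"

definition op_sim :: "'a \<Rightarrow> 'a \<Rightarrow> 'a" where
  "op_sim x y = y"

definition bd_tuple :: "('a \<Rightarrow> 'a \<Rightarrow> 'a) \<Rightarrow> 'a list \<Rightarrow> 'a list \<Rightarrow>\<^sub>0 int" where
  "bd_tuple f xs =
     frag_of (tl xs) +
     (\<Sum>i = 1..length xs - 1.
        frag_cmul ((- 1) ^ i) (frag_of (map (\<lambda>x. f x (xs ! i)) (take i xs) @ drop (Suc i) xs)))"

definition bd_op :: "('a \<Rightarrow> 'a \<Rightarrow> 'a) \<Rightarrow> ('a list \<Rightarrow>\<^sub>0 int) \<Rightarrow> ('a list \<Rightarrow>\<^sub>0 int)" where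
  "bd_op f = frag_extend (bd_tuple f)"

definition bd_ad :: "int \<Rightarrow> int \<Rightarrow> ('a list \<Rightarrow>\<^sub>0 int) \<Rightarrow> ('a list \<Rightarrow>\<^sub>0 int)" where
  "bd_ad a d c = frag_cmul a (bd_op op_zero c) + frag_cmul d (bd_op op_sim c)"

definition C_cplx :: "int \<Rightarrow> int \<Rightarrow> 'a set \<Rightarrow> ('a list \<Rightarrow>\<^sub>0 int) cplx" where
  "C_cplx a d X = \<lparr>Ch = (\<lambda>n. free_Abelian_group (tuples X n)), Bd = (\<lambda>n. bd_ad a d)\<rparr>"

text \<open>\<open>C_cplx a d {t}\<close> is the subcomplex spanned by the tuples \<open>(t, \<dots>, t)\<close>.\<close>

definition C_rel :: "int \<Rightarrow> int \<Rightarrow> 'a set \<Rightarrow> 'a \<Rightarrow> ('a list \<Rightarrow>\<^sub>0 int) set cplx" where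
  "C_rel a d X t = quot_cplx (C_cplx a d X) (C_cplx a d {t})"

definition s_zero :: "('a list \<Rightarrow>\<^sub>0 int) \<Rightarrow> ('a list \<Rightarrow>\<^sub>0 int)" where
  "s_zero = frag_extend (\<lambda>xs. frag_of (hd xs # xs))"

definition F_cplx :: "int \<Rightarrow> int \<Rightarrow> 'a set \<Rightarrow> ('a list \<Rightarrow>\<^sub>0 int) cplx" where
  "F_cplx a d X =
     \<lparr>Ch = (\<lambda>n. (Ch (C_cplx a d X) n)
        \<lparr>carrier := if n = 0 then {0} else s_zero ` carrier (Ch (C_cplx a d X) (n - 1))\<rparr>),
      Bd = Bd (C_cplx a d X)\<rparr>"

text \<open>The reduced early degenerate complex: the image of \<open>F_cplx\<close> in the relative complex.\<close>

definition F_red :: "int \<Rightarrow> int \<Rightarrow> 'a set \<Rightarrow> 'a \<Rightarrow> ('a list \<Rightarrow>\<^sub>0 int) set cplx" where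
  "F_red a d X t =
     \<lparr>Ch = (\<lambda>n. (Ch (C_rel a d X t) n)
        \<lparr>carrier := quot_proj (C_cplx a d X) (C_cplx a d {t}) n ` carrier (Ch (F_cplx a d X) n)\<rparr>),
      Bd = Bd (C_rel a d X t)\<rparr>"

text \<open>The reduced early normalized complex.\<close>

definition CeN_red :: "int \<Rightarrow> int \<Rightarrow> 'a set \<Rightarrow> 'a \<Rightarrow> ('a list \<Rightarrow>\<^sub>0 int) set set cplx" where
  "CeN_red a d X t = quot_cplx (C_rel a d X t) (F_red a d X t)"

text \<open>
  A splitting of \<open>C(X)\<close> into the three complexes: a chain isomorphism onto the direct sum that is
  compatible with the maps relating the summands to \<open>C(X)\<close>, namely the inclusion of
  \<open>C({t})\<close>, the surjection of \<open>F\<^sup>0\<close> onto its image \<open>F\<^sub>0(X,{t})\<close>, and the projection of \<open>C(X)\<close>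
  onto the normalized complex.
\<close>

definition splitting ::
  "int \<Rightarrow> int \<Rightarrow> 'a set \<Rightarrow> 'a \<Rightarrow>
   (nat \<Rightarrow> ('a list \<Rightarrow>\<^sub>0 int) \<Rightarrow>
      ('a list \<Rightarrow>\<^sub>0 int) \<times> ('a list \<Rightarrow>\<^sub>0 int) set \<times> ('a list \<Rightarrow>\<^sub>0 int) set set) \<Rightarrow> bool" where
  "splitting a d X t \<Phi> \<longleftrightarrow>
     chain_iso (C_cplx a d X)
       (sum_cplx (C_cplx a d {t}) (sum_cplx (F_red a d X t) (CeN_red a d X t))) \<Phi> \<and>
     (\<forall>n. \<forall>c \<in> carrier (Ch (C_cplx a d {t}) n).
        \<Phi> n c = (c, \<one>\<^bsub>Ch (F_red a d X t) n\<^esub>, \<one>\<^bsub>Ch (CeN_red a d X t) n\<^esub>)) \<and>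
     (\<forall>n. \<forall>c \<in> carrier (Ch (F_cplx a d X) n).
        snd (\<Phi> n c) = (quot_proj (C_cplx a d X) (C_cplx a d {t}) n c,
                        \<one>\<^bsub>Ch (CeN_red a d X t) n\<^esub>)) \<and>
     (\<forall>n. \<forall>c \<in> carrier (Ch (C_cplx a d X) n).
        snd (snd (\<Phi> n c)) =
          quot_proj (C_rel a d X t) (F_red a d X t) n
            (quot_proj (C_cplx a d X) (C_cplx a d {t}) n c))"


section \<open>The groups \<open>\<int>\<^sub>m\<^sup>k\<close> and the numbers \<open>u\<^sub>n\<close>\<close>

text \<open>\<open>\<int>\<^sub>m\<close> depends only on \<open>\<bar>m\<bar>\<close>; in the library \<open>integer_mod_group 0\<close> is \<open>\<int>\<close>.\<close>

definition Zmod :: "int \<Rightarrow> int monoid" where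
  "Zmod m = integer_mod_group (nat \<bar>m\<bar>)"

text \<open>Exponents are integer expressions in the \<open>u\<^sub>n\<close>, so \<open>k\<close> is an integer; a negative \<open>k\<close> would
  give the trivial group, but the lemmas below show that the exponents used are nonnegative.\<close>

definition Zmod_pow :: "int \<Rightarrow> int \<Rightarrow> (nat \<Rightarrow> int) monoid" where
  "Zmod_pow m k = product_group {..<nat k} (\<lambda>_. Zmod m)"

fun u :: "nat \<Rightarrow> nat \<Rightarrow> int" where
  "u q 0 = 1"
| "u q (Suc n) = int q ^ Suc n - u q n"

lemma u_closed: "(int q + 1) * u q n = int q ^ (n + 1) + (- 1) ^ n"
  by (induction n) (auto simp: algebra_simps)

lemma u_odd_nonneg:
  assumes "q \<ge> 1" "odd n"
  shows "0 \<le> u q n"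
proof -
  have "0 \<le> (int q + 1) * u q n"
    using assms by (simp add: u_closed del: power_Suc)
  then show ?thesis by (simp add: zero_le_mult_iff)
qed

lemma u_even_pos:
  assumes "q \<ge> 1" "even n"
  shows "0 \<le> u q n - 1"
proof -
  have "int q ^ 1 \<le> int q ^ (n + 1)"
    using assms by (intro power_increasing) auto
  then have "0 \<le> (int q + 1) * (u q n - 1)"
    using assms u_closed[of q n] by (simp add: right_diff_distrib)
  then show ?thesis by (simp add: zero_le_mult_iff)
qed

lemma u_diff_nonneg:
  assumes "q \<ge> 1"
  shows "0 \<le> u q (n + 1) - u q n + (- 1) ^ n"
proof -
  have eq: "(int q + 1) * (u q (n + 1) - u q n + (- 1) ^ n) =
            (int q - 1) * (int q ^ (n + 1) + (- 1) ^ n)"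
    using u_closed[of q n] u_closed[of q "n + 1"] by (simp add: algebra_simps)
  have "1 \<le> int q ^ (n + 1)"
    using assms by (intro one_le_power) auto
  then have "0 \<le> int q ^ (n + 1) + (- 1) ^ n"
    by (cases "even n") auto
  then have "0 \<le> (int q - 1) * (int q ^ (n + 1) + (- 1) ^ n)"
    using assms by (intro mult_nonneg_nonneg) auto
  then have "0 \<le> (int q + 1) * (u q (n + 1) - u q n + (- 1) ^ n)"
    using eq by simp
  then show ?thesis by (simp add: zero_le_mult_iff)
qed

end

theory Submission
  imports Defs
begin

text \<open>
  Let \<open>\<epsilon>\<close> replace every entry of a tuple by \<open>t\<close>, and let \<open>r\<close> send \<open>(x\<^sub>0, x\<^sub>1, x\<^sub>2, \<dots>)\<close> to \<open>(x\<^sub>1, x\<^sub>1, x\<^sub>2, \<dots>)\<close>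
  (and every 0-chain to 0). Both are chain maps for \<open>*\<^sub>0\<close> and \<open>*\<^sub>\<sim>\<close>, and they are commuting
  projections onto \<open>C({t})\<close> and \<open>F\<^sup>0\<close>, so \<open>\<epsilon>\<close>, \<open>r - \<epsilon>r\<close> and \<open>(1 - \<epsilon>)(1 - r)\<close> split \<open>C(X)\<close>.

  With \<open>\<kappa>\<close> appending \<open>t\<close> with the sign \<open>(-1)\<^bsup>n+1\<^esup>\<close> and \<open>s\<^sub>0\<close> doubling the first entry,
  \<open>\<partial>\<kappa> + \<kappa>\<partial> = a + d\<epsilon>\<close> and \<open>\<partial>s\<^sub>0 + s\<^sub>0\<partial> = (a + d) r\<close>. On the reduced degenerate part a Bezout
  combination of \<open>\<kappa>\<close> and \<open>s\<^sub>0\<close> contracts \<open>\<partial> / gcd(a, d)\<close>; on the reduced normalized part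
  the boundary of \<open>*\<^sub>\<sim>\<close> vanishes and \<open>\<kappa>\<close> contracts \<open>\<partial> / a\<close>. Both parts therefore have boundary \<open>g b\<close> with
  \<open>b\<close> exact, whence \<open>H\<^sub>n = Z\<^sub>n / g Z\<^sub>n\<close>, and the rank of the free group \<open>Z\<^sub>n\<close> follows from the ranks
  of the chain groups.
\<close>


section \<open>Free abelian groups of finite rank\<close>

text \<open>A set of elements of a type in \<open>ab_group_add\<close> becomes a monoid record, so
  that chain computations use \<open>+\<close> and \<open>-\<close> while the homology layer sees
  groups.\<close>

definition add_grp :: "'g::ab_group_add set \<Rightarrow> 'g monoid" where
  "add_grp M = \<lparr>carrier = M, monoid.mult = (+), one = 0\<rparr>"

definition add_sub :: "'g::ab_group_add set \<Rightarrow> bool" where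
  "add_sub M \<longleftrightarrow> 0 \<in> M \<and> (\<forall>x\<in>M. \<forall>y\<in>M. x - y \<in> M)"

lemma add_grp_simps [simp]:
  "carrier (add_grp M) = M" "x \<otimes>\<^bsub>add_grp M\<^esub> y = x + y" "\<one>\<^bsub>add_grp M\<^esub> = 0"
  "(add_grp M)\<lparr>carrier := M'\<rparr> = add_grp M'"
  by (simp_all add: add_grp_def)

lemma add_sub_closed:
  assumes "add_sub M"
  shows "0 \<in> M" "x \<in> M \<Longrightarrow> y \<in> M \<Longrightarrow> x - y \<in> M" "x \<in> M \<Longrightarrow> - x \<in> M"
    "x \<in> M \<Longrightarrow> y \<in> M \<Longrightarrow> x + y \<in> M"
proof -
  show 0: "0 \<in> M" and d: "\<And>x y. x \<in> M \<Longrightarrow> y \<in> M \<Longrightarrow> x - y \<in> M"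
    using assms by (auto simp: add_sub_def)
  show m: "- x \<in> M" if "x \<in> M" for x using d[OF 0 that] by simp
  show "x \<in> M \<Longrightarrow> y \<in> M \<Longrightarrow> x + y \<in> M" using d[of x "- y"] m[of y] by simp
qed

lemma comm_group_add_grp [intro]: "add_sub M \<Longrightarrow> comm_group (add_grp M)"
  by (rule comm_groupI)
    (auto simp: add_sub_closed ac_simps intro!: bexI[of _ "- _"])

lemma inv_add_grp [simp]: "add_sub M \<Longrightarrow> x \<in> M \<Longrightarrow> inv\<^bsub>add_grp M\<^esub> x = - x"
  by (rule group.inv_equality) (auto simp: add_sub_closed intro!: comm_group.axioms)

lemma subgroup_add_grp [intro]:
  "add_sub M \<Longrightarrow> add_sub M' \<Longrightarrow> M' \<subseteq> M \<Longrightarrow> subgroup M' (add_grp M)"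
  by (rule group.subgroupI)
    (auto simp: add_sub_closed subsetD dest: add_sub_closed(1) intro!: comm_group.axioms)

lemma add_sub_cmul:
  fixes M :: "('b \<Rightarrow>\<^sub>0 int) set"
  assumes "add_sub M" "x \<in> M"
  shows "frag_cmul n x \<in> M"
proof -
  have *: "frag_cmul (int m) x \<in> M" for m
    by (induction m) (auto simp: add_sub_closed assms frag_cmul_distrib)
  show ?thesis
    using *[of "nat n"] add_sub_closed(3)[OF assms(1) *[of "nat (- n)"]]
    by (cases "n \<ge> 0") auto
qed

text \<open>An additive bijection from \<open>M\<close> onto Z^k, expressed without a basis. Only
  the values of an integer sequence below \<open>k\<close> count, so no separate type for Z^k is
  required.\<close>

definition coords :: "('g::ab_group_add \<Rightarrow> nat \<Rightarrow> int) \<Rightarrow> 'g set \<Rightarrow> nat \<Rightarrow> bool" where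
  "coords \<phi> M k \<longleftrightarrow>
     (\<forall>x\<in>M. \<forall>y\<in>M. \<forall>i<k. \<phi> (x + y) i = \<phi> x i + \<phi> y i) \<and>
     (\<forall>v. \<exists>!x. x \<in> M \<and> (\<forall>i<k. \<phi> x i = v i))"

definition free_rank :: "'g::ab_group_add set \<Rightarrow> nat \<Rightarrow> bool" where
  "free_rank M k \<longleftrightarrow> add_sub M \<and> (\<exists>\<phi>. coords \<phi> M k)"

lemma coords_cmul:
  fixes M :: "('b \<Rightarrow>\<^sub>0 int) set"
  assumes M: "add_sub M" "coords \<phi> M k" "x \<in> M" "i < k"
  shows "\<phi> (frag_cmul n x) i = n * \<phi> x i"
proof -
  have f: "\<phi> (x + y) i = \<phi> x i + \<phi> y i" if "x \<in> M" "y \<in> M" for x y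
    using assms that by (auto simp: coords_def)
  have 0: "\<phi> 0 i = 0" using f[of 0 0] M by (simp add: add_sub_closed)
  have *: "\<phi> (frag_cmul (int m) x) i = int m * \<phi> x i" for m
    by (induction m) (auto simp: 0 f M add_sub_cmul frag_cmul_distrib algebra_simps)
  have "\<phi> (- y) i = - \<phi> y i" if "y \<in> M" for y
    using f[of y "- y"] that M by (simp add: add_sub_closed 0)
  then show ?thesis
    using *[of "nat n"] *[of "nat (- n)"] add_sub_cmul[OF M(1,3)]
    by (cases "n \<ge> 0") (simp_all, metis minus_equation_iff minus_frag_cmul mult_minus_left)
qed

section \<open>Quotients by multiples, and uniqueness of the rank\<close>

lemma group_Zmod [simp]: "group (Zmod g)"
  by (simp add: Zmod_def)

lemma comm_group_product_Zmod: "comm_group (product_group I (\<lambda>_. Zmod g))"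
  by (rule group.group_comm_groupI) (auto simp: Zmod_def add.commute)

lemma carrier_Zmod: "g \<noteq> 0 \<Longrightarrow> carrier (Zmod g) = {0..<\<bar>g\<bar>}"
  by (simp add: Zmod_def carrier_integer_mod_group)

lemma mod_abs_in_Zmod: "x mod \<bar>g\<bar> \<in> carrier (Zmod g)"
  by (auto simp: Zmod_def carrier_integer_mod_group)

lemma Zmod_mod_abs: "x \<in> carrier (Zmod g) \<Longrightarrow> x mod \<bar>g\<bar> = x"
  by (auto simp: Zmod_def carrier_integer_mod_group split: if_splits)

text \<open>Reducing all coordinates modulo |g| is onto, with kernel \<open>g M\<close>. The case
  \<open>g = 0\<close> is included: then \<open>mod\<close> changes nothing and
  \<open>Zmod 0\<close> is Z, so the coordinate map itself is the isomorphism.\<close>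

lemma Mod_cmul_iso:
  fixes M :: "('b \<Rightarrow>\<^sub>0 int) set"
  assumes "free_rank M k"
  shows "add_grp M Mod (frag_cmul g ` M) \<cong> product_group {..<k} (\<lambda>_. Zmod g)"
proof -
  let ?P = "product_group {..<k} (\<lambda>_. Zmod g)"
  obtain \<phi> where M: "add_sub M" and \<phi>: "coords \<phi> M k"
    using assms by (auto simp: free_rank_def)
  define f where "f x = (\<lambda>i\<in>{..<k}. \<phi> x i mod \<bar>g\<bar>)" for x
  have fh: "f \<in> hom (add_grp M) ?P"
  proof (rule homI)
    show "f x \<in> carrier ?P" for x by (auto simp: f_def mod_abs_in_Zmod)
    show "f (x \<otimes>\<^bsub>add_grp M\<^esub> y) = f x \<otimes>\<^bsub>?P\<^esub> f y"
      if "x \<in> carrier (add_grp M)" "y \<in> carrier (add_grp M)" for x y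
      using that \<phi> by (auto simp: f_def coords_def Zmod_def mod_simps)
  qed
  interpret f: group_hom "add_grp M" ?P f
    using M fh comm_group_product_Zmod
    by (intro group_hom.intro group_hom_axioms.intro comm_group.axioms) auto
  have "f ` M = carrier ?P"
  proof
    show "f ` M \<subseteq> carrier ?P" using fh by (auto simp: hom_def)
    show "carrier ?P \<subseteq> f ` M"
    proof
      fix v assume v: "v \<in> carrier ?P"
      obtain x where x: "x \<in> M" "\<forall>i<k. \<phi> x i = v i"
        using \<phi> unfolding coords_def by metis
      have "f x = v"
        using v x by (auto simp: f_def fun_eq_iff Zmod_mod_abs PiE_iff extensional_def)
      with x show "v \<in> f ` M" by blast
    qed
  qed
  moreover have "kernel (add_grp M) ?P f = frag_cmul g ` M"
  proof (intro equalityI subsetI)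
    fix x assume "x \<in> kernel (add_grp M) ?P f"
    then have x: "x \<in> M" "\<forall>i<k. \<phi> x i mod \<bar>g\<bar> = 0"
      by (auto simp: kernel_def f_def Zmod_def fun_eq_iff restrict_def split: if_splits)
    \<comment> \<open>Divisibility of every coordinate yields a vector of quotients; existence in
      \<open>coords\<close> realises it by some \<open>y\<close> in \<open>M\<close>, and uniqueness
      identifies \<open>x\<close> with \<open>g y\<close>.\<close>
    then have "\<forall>i<k. \<exists>v. \<phi> x i = g * v" unfolding mod_eq_0_iff_dvd abs_dvd_iff by (auto simp: dvd_def)
    then obtain v where v: "\<forall>i<k. \<phi> x i = g * v i" by metis
    obtain y where y: "y \<in> M" "\<forall>i<k. \<phi> y i = v i"
      using \<phi> unfolding coords_def by metis
    have "\<forall>i<k. \<phi> (frag_cmul g y) i = \<phi> x i"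
      using coords_cmul[OF M \<phi> y(1)] v y by auto
    moreover have "frag_cmul g y \<in> M" using M y by (simp add: add_sub_cmul)
    ultimately have "frag_cmul g y = x"
      using \<phi> x unfolding coords_def by metis
    with y show "x \<in> frag_cmul g ` M" by blast
  next
    fix x assume "x \<in> frag_cmul g ` M"
    then obtain y where "y \<in> M" "x = frag_cmul g y" by blast
    then show "x \<in> kernel (add_grp M) ?P f"
      using coords_cmul[OF M \<phi>] add_sub_cmul[OF M]
      by (auto simp: kernel_def f_def Zmod_def fun_eq_iff restrict_def)
  qed
  ultimately show ?thesis using f.FactGroup_iso by simp
qed

text \<open>Counting: M / 2M has 2^k elements, and this number determines k.\<close>

lemma free_rank_unique:
  fixes M :: "('b \<Rightarrow>\<^sub>0 int) set"
  assumes "free_rank M k" "free_rank M l"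
  shows "k = l"
proof -
  have card: "card (carrier (add_grp M Mod (frag_cmul 2 ` M))) = 2 ^ k" if k: "free_rank M k" for k
  proof -
    obtain h where "bij_betw h (carrier (add_grp M Mod (frag_cmul 2 ` M)))
        (carrier (product_group {..<k} (\<lambda>_. Zmod 2)))"
      using Mod_cmul_iso[OF k, of 2] by (auto simp: is_iso_def iso_def)
    then show ?thesis
      by (simp add: bij_betw_same_card card_PiE carrier_Zmod)
  qed
  show ?thesis using card[OF assms(1)] card[OF assms(2)] by simp
qed

section \<open>Constructions of groups of known rank\<close>

lemma free_rank_trivial: "free_rank {0} 0"
  by (auto simp: free_rank_def add_sub_def coords_def)

lemma free_rank_plus:
  assumes "free_rank A k" "free_rank B l" and AB: "A \<inter> B = {0}"
    and Mdef: "M = {x + y | x y. x \<in> A \<and> y \<in> B}"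
  shows "free_rank M (k + l)"
proof -
  obtain \<phi> \<psi> where A: "add_sub A" and \<phi>: "coords \<phi> A k" and B: "add_sub B" and \<psi>: "coords \<psi> B l"
    using assms by (auto simp: free_rank_def)
  \<comment> \<open>The component in \<open>A\<close> of a sum; it is well defined because
    \<open>A\<close> and \<open>B\<close> meet only in 0.\<close>
  define p where "p z = (THE x. x \<in> A \<and> z - x \<in> B)" for z
  have p: "p (x + y) = x" if "x \<in> A" "y \<in> B" for x y
    unfolding p_def
  proof (rule the_equality)
    show "x \<in> A \<and> x + y - x \<in> B" using that by simp
    fix x' assume x': "x' \<in> A \<and> x + y - x' \<in> B"
    then have "x' - x \<in> A" "y - (x + y - x') \<in> B"
      using that A B add_sub_closed(2) by blast+
    then have "x' - x \<in> A \<inter> B" by (simp add: algebra_simps)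
    then show "x' = x" using AB by simp
  qed
  define \<theta> where "\<theta> z i = (if i < k then \<phi> (p z) i else \<psi> (z - p z) (i - k))" for z i
  have \<theta>: "\<theta> (x + y) i = (if i < k then \<phi> x i else \<psi> y (i - k))" if "x \<in> A" "y \<in> B" for x y i
    using that by (simp add: \<theta>_def p)
  have "coords \<theta> M (k + l)"
    unfolding coords_def
  proof (intro conjI ballI allI impI)
    fix z w i assume "z \<in> M" "w \<in> M" and i: "i < k + l"
    then obtain x y x' y' where e: "x \<in> A" "y \<in> B" "z = x + y" "x' \<in> A" "y' \<in> B" "w = x' + y'"
      unfolding Mdef by blast
    have zw: "z + w = (x + x') + (y + y')" using e by (simp add: algebra_simps)
    have "\<theta> (z + w) i = (if i < k then \<phi> (x + x') i else \<psi> (y + y') (i - k))"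
      unfolding zw using e A B by (intro \<theta>) (auto simp: add_sub_closed)
    moreover have "\<theta> z i = (if i < k then \<phi> x i else \<psi> y (i - k))"
      "\<theta> w i = (if i < k then \<phi> x' i else \<psi> y' (i - k))" using e \<theta> by auto
    ultimately show "\<theta> (z + w) i = \<theta> z i + \<theta> w i"
      using e(1,2,4,5) i \<phi> \<psi> by (auto simp: coords_def)
  next
    fix v :: "nat \<Rightarrow> int"
    obtain x where x: "x \<in> A" "\<forall>i<k. \<phi> x i = v i"
      using \<phi> unfolding coords_def by metis
    obtain y where y: "y \<in> B" "\<forall>i<l. \<psi> y i = v (k + i)"
      using \<psi>[unfolded coords_def, THEN conjunct2, THEN spec, of "\<lambda>i. v (k + i)"] by auto
    show "\<exists>!z. z \<in> M \<and> (\<forall>i<k + l. \<theta> z i = v i)"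
    proof (rule ex1I[of _ "x + y"])
      show "x + y \<in> M \<and> (\<forall>i<k + l. \<theta> (x + y) i = v i)"
        using x y unfolding Mdef by (auto simp: \<theta>)
      fix z assume z: "z \<in> M \<and> (\<forall>i<k + l. \<theta> z i = v i)"
      then obtain x' y' where e: "x' \<in> A" "y' \<in> B" "z = x' + y'"
        unfolding Mdef by blast
      have "\<forall>i<k. \<phi> x' i = v i" using z e \<theta>[of x' y'] by (metis trans_less_add1)
      then have "x' = x" using \<phi> x e unfolding coords_def by metis
      moreover have "\<psi> y' i = v (k + i)" if "i < l" for i
        using z that e \<theta>[of x' y' "k + i"] by auto
      then have "y' = y" using \<psi>[unfolded coords_def, THEN conjunct2, THEN spec, of "\<lambda>i. v (k + i)"] y e by metis
      ultimately show "z = x + y" using e by simp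
    qed
  qed
  moreover have "add_sub M"
    unfolding add_sub_def
  proof (intro conjI ballI)
    show "0 \<in> M"
      unfolding Mdef using add_sub_closed(1)[OF A] add_sub_closed(1)[OF B] by force
    fix z w assume "z \<in> M" "w \<in> M"
    then obtain x y x' y' where e: "x \<in> A" "y \<in> B" "z = x + y" "x' \<in> A" "y' \<in> B" "w = x' + y'"
      unfolding Mdef by blast
    have "z - w = (x - x') + (y - y')" using e by (simp add: algebra_simps)
    moreover have "x - x' \<in> A" "y - y' \<in> B" using e A B by (auto simp: add_sub_closed)
    ultimately show "z - w \<in> M" unfolding Mdef by blast
  qed
  ultimately show ?thesis by (auto simp: free_rank_def)
qed

lemma free_rank_iso:
  assumes "free_rank M k" "bij_betw f M N" "add_sub N"
    and f: "\<And>x y. x \<in> M \<Longrightarrow> y \<in> M \<Longrightarrow> f (x + y) = f x + f y"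
  shows "free_rank N k"
proof -
  obtain \<phi> where M: "add_sub M" and \<phi>: "coords \<phi> M k"
    using assms by (auto simp: free_rank_def)
  let ?g = "inv_into M f"
  have fg: "f (?g y) = y" "?g y \<in> M" if "y \<in> N" for y
    using that assms(2) by (auto simp: bij_betw_def f_inv_into_f inv_into_into)
  have gf: "?g (f x) = x" if "x \<in> M" for x
    using that assms(2) by (auto simp: bij_betw_def)
  have g: "?g (x + y) = ?g x + ?g y" if "x \<in> N" "y \<in> N" for x y
    using that f[of "?g x" "?g y"] fg gf[of "?g x + ?g y"] M by (simp add: add_sub_closed)
  have "coords (\<lambda>y. \<phi> (?g y)) N k"
    unfolding coords_def
  proof (intro conjI ballI allI impI)
    fix v :: "nat \<Rightarrow> int"
    obtain x where x: "x \<in> M" "\<forall>i<k. \<phi> x i = v i"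
      using \<phi> unfolding coords_def by metis
    have u: "y = x" if "y \<in> M" "\<forall>i<k. \<phi> y i = v i" for y
      using \<phi> x that unfolding coords_def by metis
    show "\<exists>!y. y \<in> N \<and> (\<forall>i<k. \<phi> (?g y) i = v i)"
    proof (rule ex1I[of _ "f x"])
      show "f x \<in> N \<and> (\<forall>i<k. \<phi> (?g (f x)) i = v i)"
        using x gf bij_betwE[OF assms(2)] by simp
      fix y assume "y \<in> N \<and> (\<forall>i<k. \<phi> (?g y) i = v i)"
      then show "y = f x" using u[of "?g y"] fg[of y] by simp
    qed
  next
    fix x y i assume "x \<in> N" "y \<in> N" "i < k"
    then show "\<phi> (?g (x + y)) i = \<phi> (?g x) i + \<phi> (?g y) i"
      using \<phi> fg g by (simp add: coords_def)
  qed
  then show ?thesis using assms(3) by (auto simp: free_rank_def)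
qed

text \<open>A nonzero chain has a nonzero coefficient, and comparing this coefficient shows that
  distinct integer multiples of \<open>b\<close> are distinct.\<close>

lemma free_rank_cyclic:
  fixes b :: "'b \<Rightarrow>\<^sub>0 int"
  assumes "b \<noteq> 0"
  shows "free_rank (range (\<lambda>n. frag_cmul n b)) 1"
proof -
  have inj: "m = n" if "frag_cmul m b = frag_cmul n b" for m n
  proof -
    obtain x where "Poly_Mapping.lookup b x \<noteq> 0" using assms by (auto simp: poly_mapping_eq_iff fun_eq_iff)
    moreover have "m * Poly_Mapping.lookup b x = n * Poly_Mapping.lookup b x" using that by (metis lookup_frag_cmul)
    ultimately show ?thesis by simp
  qed
  have "free_rank (UNIV :: int set) 1"
    unfolding free_rank_def add_sub_def coords_def by (auto intro!: exI[of _ "\<lambda>x _. x"])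
  then show ?thesis
  proof (rule free_rank_iso)
    show "bij_betw (\<lambda>n. frag_cmul n b) UNIV (range (\<lambda>n. frag_cmul n b))"
      using inj by (auto simp: bij_betw_def inj_def)
    show "add_sub (range (\<lambda>n. frag_cmul n b))"
      unfolding add_sub_def
      by (auto simp flip: frag_cmul_diff_distrib intro: range_eqI[where x = 0])
  qed (rule frag_cmul_distrib)
qed

section \<open>Chains supported in a finite set, and their subgroups\<close>

lemma add_sub_keys: "add_sub {c :: 'b \<Rightarrow>\<^sub>0 int. Poly_Mapping.keys c \<subseteq> S}"
  using keys_diff by (fastforce simp: add_sub_def)

text \<open>Division with remainder by the least positive element; without positive elements the
  generator is 0.\<close>

lemma int_subgroup_cyclic:
  assumes "add_sub (M :: int set)"
  shows "\<exists>g\<in>M. \<forall>x\<in>M. g dvd x"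
proof (cases "\<exists>x\<in>M. x > 0")
  case False
  then have "x = 0" if "x \<in> M" for x
    using add_sub_closed(3)[OF assms that] that by (meson linorder_cases neg_0_less_iff_less)
  then show ?thesis using add_sub_closed(1)[OF assms] by fastforce
next
  case True
  then obtain x where "x \<in> M" "x > 0" by blast
  then have ex: "\<exists>n. n > 0 \<and> int n \<in> M" by (intro exI[of _ "nat x"]) auto
  define n where "n = (LEAST n. n > 0 \<and> int n \<in> M)"
  have n: "n > 0" "int n \<in> M" using LeastI_ex[OF ex] by (auto simp: n_def)
  have least: "n \<le> m" if "m > 0" "int m \<in> M" for m
    unfolding n_def using that by (intro Least_le) auto
  have mult: "k * int n \<in> M" for k
  proof -
    have *: "int m * int n \<in> M" for m
      by (induction m) (use n add_sub_closed[OF assms] in \<open>auto simp: algebra_simps\<close>)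
    show ?thesis
      using *[of "nat k"] add_sub_closed(3)[OF assms *[of "nat (- k)"]] by (cases "k \<ge> 0") auto
  qed
  have "int n dvd x" if "x \<in> M" for x
  proof -
    have "x mod int n \<in> M"
      using add_sub_closed(2)[OF assms that mult[of "x div int n"]] by (simp add: minus_div_mult_eq_mod)
    moreover have "0 \<le> x mod int n" "x mod int n < int n" using n by auto
    ultimately have "x mod int n = 0"
      using least[of "nat (x mod int n)"] by (cases "x mod int n = 0") auto
    then show ?thesis by auto
  qed
  then show ?thesis using n by blast
qed

text \<open>The proof splits off one coordinate at a time.\<close>

lemma free_rank_subgroup:
  fixes M :: "('b \<Rightarrow>\<^sub>0 int) set"
  assumes "finite S" "add_sub M" "\<And>c. c \<in> M \<Longrightarrow> Poly_Mapping.keys c \<subseteq> S"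
  shows "\<exists>k. free_rank M k"
  using assms
proof (induction S arbitrary: M rule: finite_induct)
  case empty
  then have "M = {0}" by (auto simp: add_sub_closed)
  then show ?case using free_rank_trivial by blast
next
  case (insert x S)
  note M = insert.prems(1)
  let ?L = "(\<lambda>c. Poly_Mapping.lookup c x) ` M"
  define M0 where "M0 = {c \<in> M. Poly_Mapping.lookup c x = 0}"
  have M0: "add_sub M0" using M by (auto simp: M0_def add_sub_def lookup_minus)
  have "Poly_Mapping.keys c \<subseteq> S" if "c \<in> M0" for c
    using that insert.prems(2)[of c] by (auto simp: M0_def in_keys_iff)
  with insert.IH[OF M0] obtain k where k: "free_rank M0 k" by blast
  have "add_sub ?L" 
    using M by (auto simp: add_sub_def simp flip: lookup_minus intro: image_eqI[of _ _ 0])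
  \<comment> \<open>\<open>b\<close> realises a generator of the group of coefficients at
    \<open>x\<close>. If this generator is 0, then \<open>M\<close> equals \<open>M0\<close>;
    otherwise \<open>M\<close> is the direct sum of the multiples of \<open>b\<close> and
    \<open>M0\<close>.\<close>
  then obtain b where b: "b \<in> M" "\<And>c. c \<in> M \<Longrightarrow> Poly_Mapping.lookup b x dvd Poly_Mapping.lookup c x"
    using int_subgroup_cyclic by blast
  show ?case
  proof (cases "Poly_Mapping.lookup b x = 0")
    case True
    then have "M0 = M" using b by (auto simp: M0_def)
    then show ?thesis using k by blast
  next
    case False
    then have "b \<noteq> 0" by auto
    note R = free_rank_cyclic[OF this]
    have "range (\<lambda>n. frag_cmul n b) \<inter> M0 = {0}"
      using False add_sub_closed(1)[OF M0] by (auto simp: M0_def intro: range_eqI[where x = 0])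
    moreover have "M = {y + z | y z. y \<in> range (\<lambda>n. frag_cmul n b) \<and> z \<in> M0}"
    proof (intro equalityI subsetI)
      fix c assume c: "c \<in> M"
      then obtain n where n: "Poly_Mapping.lookup c x = Poly_Mapping.lookup b x * n"
        using b by (auto simp: dvd_def)
      have "c - frag_cmul n b \<in> M0"
        using n c b add_sub_cmul[OF M] M by (auto simp: M0_def add_sub_closed lookup_minus)
      then show "c \<in> {y + z | y z. y \<in> range (\<lambda>n. frag_cmul n b) \<and> z \<in> M0}"
        by (intro CollectI exI[of _ "frag_cmul n b"] exI[of _ "c - frag_cmul n b"]) auto
    qed (use M b add_sub_cmul[OF M] in \<open>auto simp: M0_def add_sub_closed\<close>)
    ultimately show ?thesis using free_rank_plus[OF R k] by blast
  qed
qed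

lemma free_rank_keys:
  assumes "finite S"
  shows "free_rank {c :: 'b \<Rightarrow>\<^sub>0 int. Poly_Mapping.keys c \<subseteq> S} (card S)"
  using assms
proof (induction S rule: finite_induct)
  case empty
  show ?case using free_rank_trivial by simp
next
  case (insert x S)
  let ?R = "range (\<lambda>n. frag_cmul n (frag_of x))"
  let ?F = "\<lambda>S. {c :: 'b \<Rightarrow>\<^sub>0 int. Poly_Mapping.keys c \<subseteq> S}"
  have R: "free_rank ?R 1" by (rule free_rank_cyclic) simp
  have 0: "?R \<inter> ?F S = {0}"
    using insert.hyps by (auto simp: keys_frag_of subset_iff intro: range_eqI[where x = 0])
  have "?F (insert x S) = {y + z | y z. y \<in> ?R \<and> z \<in> ?F S}"
  proof (intro equalityI subsetI)
    fix c assume c: "c \<in> ?F (insert x S)"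
    let ?d = "frag_cmul (Poly_Mapping.lookup c x) (frag_of x)"
    have "Poly_Mapping.keys (c - ?d) \<subseteq> insert x S"
      using c keys_diff[of c ?d] by (auto simp: keys_frag_of subset_iff)
    moreover have "x \<notin> Poly_Mapping.keys (c - ?d)" by (simp add: in_keys_iff lookup_minus)
    ultimately have "c - ?d \<in> ?F S" by auto
    then show "c \<in> {y + z | y z. y \<in> ?R \<and> z \<in> ?F S}"
      by (intro CollectI exI[of _ ?d] exI[of _ "c - ?d"]) auto
  next
    fix c assume "c \<in> {y + z | y z. y \<in> ?R \<and> z \<in> ?F S}"
    then obtain n z where "c = frag_cmul n (frag_of x) + z" "Poly_Mapping.keys z \<subseteq> S" by blast
    then show "c \<in> ?F (insert x S)"
      using keys_add[of "frag_cmul n (frag_of x)" z] by (auto simp: keys_frag_of)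
  qed
  from free_rank_plus[OF R insert.IH 0 this] show ?case
    using insert.hyps by simp
qed


section \<open>Homology of chain complexes\<close>

text \<open>First isomorphism theorem for the composite of \<open>f\<close> with the projection of
  \<open>H\<close> modulo \<open>B'\<close>: its kernel is \<open>B\<close> by the last
  hypothesis.\<close>

lemma Mod_iso:
  assumes G: "comm_group G" and H: "comm_group H" and f: "f \<in> hom G H"
    and onto: "f ` carrier G = carrier H" and B: "subgroup B G" and B': "subgroup B' H"
    and BB: "\<And>x. x \<in> carrier G \<Longrightarrow> f x \<in> B' \<longleftrightarrow> x \<in> B"
  shows "G Mod B \<cong> H Mod B'"
proof -
  interpret H: comm_group H by fact
  interpret N: normal B' H using B' by (rule H.subgroup_imp_normal)
  interpret q: group_hom G "H Mod B'" "\<lambda>x. B' #>\<^bsub>H\<^esub> f x"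
  proof (intro group_hom.intro group_hom_axioms.intro homI)
    fix x y assume "x \<in> carrier G" "y \<in> carrier G"
    then show "B' #>\<^bsub>H\<^esub> f (x \<otimes>\<^bsub>G\<^esub> y) = (B' #>\<^bsub>H\<^esub> f x) \<otimes>\<^bsub>H Mod B'\<^esub> (B' #>\<^bsub>H\<^esub> f y)"
      using f by (simp add: hom_mult hom_in_carrier N.rcos_sum)
  qed (use G f N.factorgroup_is_group in \<open>auto simp: comm_group.axioms carrier_FactGroup hom_in_carrier\<close>)
  have "kernel G (H Mod B') (\<lambda>x. B' #>\<^bsub>H\<^esub> f x) = B"
  proof (intro equalityI subsetI)
    fix x assume "x \<in> kernel G (H Mod B') (\<lambda>x. B' #>\<^bsub>H\<^esub> f x)"
    then have "x \<in> carrier G" "B' #>\<^bsub>H\<^esub> f x = B'" by (auto simp: kernel_def)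
    then show "x \<in> B"
      using BB H.coset_join1[OF _ _ B'] subgroup.subset[OF B'] hom_in_carrier[OF f] by blast
  next
    fix x assume "x \<in> B"
    moreover from this have "x \<in> carrier G" using subgroup.subset[OF B] by blast
    ultimately show "x \<in> kernel G (H Mod B') (\<lambda>x. B' #>\<^bsub>H\<^esub> f x)"
      using BB H.coset_join2[OF _ B'] hom_in_carrier[OF f] by (auto simp: kernel_def)
  qed
  moreover have "(\<lambda>x. B' #>\<^bsub>H\<^esub> f x) ` carrier G = carrier (H Mod B')"
    unfolding carrier_FactGroup onto[symmetric] by (simp add: image_image)
  ultimately show ?thesis using q.FactGroup_iso by simp
qed

section \<open>Cycles, boundaries and the invariance of homology\<close>

lemma chain_complexD:
  assumes "chain_complex C"
  shows "comm_group (Ch C n)" "Bd C (Suc n) \<in> hom (Ch C (Suc n)) (Ch C n)"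
    "c \<in> carrier (Ch C (Suc (Suc n))) \<Longrightarrow> Bd C (Suc n) (Bd C (Suc (Suc n)) c) = \<one>\<^bsub>Ch C n\<^esub>"
    "group (Ch C n)" "group_hom (Ch C (Suc n)) (Ch C n) (Bd C (Suc n))"
  using assms unfolding chain_complex_def
  by (auto intro!: group_hom.intro group_hom_axioms.intro comm_group.axioms)

lemma cycles_0: "cycles C 0 = carrier (Ch C 0)"
  and cycles_Suc: "cycles C (Suc n) = kernel (Ch C (Suc n)) (Ch C n) (Bd C (Suc n))"
  by (simp_all add: cycles_def)

lemma subgroup_cycles: "chain_complex C \<Longrightarrow> subgroup (cycles C n) (Ch C n)"
  by (cases n)
    (simp_all add: cycles_0 cycles_Suc group.subgroup_self chain_complexD group_hom.subgroup_kernel)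

lemma boundaries_subset_cycles: "chain_complex C \<Longrightarrow> boundaries C n \<subseteq> cycles C n"
  by (cases n) (auto simp: boundaries_def cycles_0 cycles_Suc kernel_def chain_complexD
      intro!: hom_in_carrier[OF chain_complexD(2)])

lemma subgroup_boundaries:
  assumes "chain_complex C"
  shows "subgroup (boundaries C n) ((Ch C n)\<lparr>carrier := cycles C n\<rparr>)"
  unfolding boundaries_def
  using assms boundaries_subset_cycles[OF assms, unfolded boundaries_def] subgroup_cycles[OF assms]
  by (intro group.subgroup_incl group_hom.img_is_subgroup) (auto simp: chain_complexD)

lemma comm_group_cycles:
  "chain_complex C \<Longrightarrow> comm_group ((Ch C n)\<lparr>carrier := cycles C n\<rparr>)"
proof -
  assume C: "chain_complex C"
  interpret comm_group "Ch C n" using C by (rule chain_complexD)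
  show ?thesis
    using subgroup_cycles[OF C, of n] subgroup.subset[OF subgroup_cycles[OF C], of n]
    by (intro group.group_comm_groupI subgroup.subgroup_is_group) (auto simp: m_comm subsetD)
qed

lemma group_homology: "chain_complex C \<Longrightarrow> group (homology C n)"
  unfolding homology_def
  by (intro normal.factorgroup_is_group comm_group.subgroup_imp_normal comm_group_cycles
      subgroup_boundaries)

lemma homology_chain_iso:
  assumes C: "chain_complex C" and D: "chain_complex D" and \<Phi>: "chain_iso C D \<Phi>"
  shows "homology C n \<cong> homology D n"
proof -
  have iso: "\<Phi> n \<in> hom (Ch C n) (Ch D n)" "bij_betw (\<Phi> n) (carrier (Ch C n)) (carrier (Ch D n))" for n
    using \<Phi> by (auto simp: chain_iso_def iso_def)
  have comm: "\<Phi> n (Bd C (Suc n) c) = Bd D (Suc n) (\<Phi> (Suc n) c)" if "c \<in> carrier (Ch C (Suc n))" for n c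
    using \<Phi> that by (auto simp: chain_iso_def)
  \<comment> \<open>Injectivity detects the neutral element; with compatibility of boundaries this
    matches cycles with cycles.\<close>
  have one: "\<Phi> n c = \<one>\<^bsub>Ch D n\<^esub> \<longleftrightarrow> c = \<one>\<^bsub>Ch C n\<^esub>" if "c \<in> carrier (Ch C n)" for n c
    using iso that group.is_monoid[OF chain_complexD(4)[OF C]] hom_one[OF iso(1)] chain_complexD(4)[OF C]
      chain_complexD(4)[OF D] monoid.one_closed unfolding bij_betw_def inj_on_def by metis
  have onto: "\<Phi> n ` carrier (Ch C n) = carrier (Ch D n)" for n
    using iso(2) by (auto simp: bij_betw_def)
  have cyc: "\<Phi> n c \<in> cycles D n \<longleftrightarrow> c \<in> cycles C n" if "c \<in> carrier (Ch C n)" for n c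
  proof (cases n)
    case (Suc m)
    then show ?thesis
      using that comm[of c m] one[of "Bd C (Suc m) c" m] hom_in_carrier[OF chain_complexD(2)[OF C], of c m] onto
      by (auto simp: cycles_Suc kernel_def)
  qed (use that onto in \<open>auto simp: cycles_0\<close>)
  \<comment> \<open>A boundary in \<open>D\<close> lifts because \<Phi> is onto in degree n + 1, and
    the lift bounds the given chain because \<Phi> is injective in degree n.\<close>
  have bnd: "\<Phi> n c \<in> boundaries D n \<longleftrightarrow> c \<in> boundaries C n" if c: "c \<in> carrier (Ch C n)" for c
  proof
    assume "\<Phi> n c \<in> boundaries D n"
    then obtain x where x: "x \<in> carrier (Ch C (Suc n))" "\<Phi> n c = Bd D (Suc n) (\<Phi> (Suc n) x)"
      unfolding boundaries_def using onto by (metis imageE)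
    then have "\<Phi> n c = \<Phi> n (Bd C (Suc n) x)" using comm by simp
    then have "c = Bd C (Suc n) x"
      using iso(2)[of n] c x(1) hom_in_carrier[OF chain_complexD(2)[OF C]] unfolding bij_betw_def
      by (meson inj_onD)
    then show "c \<in> boundaries C n" using x by (auto simp: boundaries_def)
  next
    assume "c \<in> boundaries C n"
    then obtain x where "x \<in> carrier (Ch C (Suc n))" "c = Bd C (Suc n) x"
      by (auto simp: boundaries_def)
    then show "\<Phi> n c \<in> boundaries D n"
      using comm[of x n] onto[of "Suc n"] by (auto simp: boundaries_def)
  qed
  have sub: "cycles C n \<subseteq> carrier (Ch C n)" "cycles D n \<subseteq> carrier (Ch D n)" for n
    using subgroup.subset[OF subgroup_cycles] C D by blast+
  show ?thesis
    unfolding homology_def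
  proof (rule Mod_iso[OF comm_group_cycles[OF C] comm_group_cycles[OF D], of "\<Phi> n"])
    show "\<Phi> n \<in> hom ((Ch C n)\<lparr>carrier := cycles C n\<rparr>) ((Ch D n)\<lparr>carrier := cycles D n\<rparr>)"
      using iso(1)[of n] subsetD[OF sub(1)] cyc by (simp add: hom_def Pi_iff)
    show "\<Phi> n ` carrier ((Ch C n)\<lparr>carrier := cycles C n\<rparr>) = carrier ((Ch D n)\<lparr>carrier := cycles D n\<rparr>)"
    proof (intro equalityI subsetI)
      fix y assume "y \<in> carrier ((Ch D n)\<lparr>carrier := cycles D n\<rparr>)"
      then have y: "y \<in> cycles D n" by simp
      with sub(2)[of n] onto[of n] obtain x where "x \<in> carrier (Ch C n)" "y = \<Phi> n x" by blast
      then show "y \<in> \<Phi> n ` carrier ((Ch C n)\<lparr>carrier := cycles C n\<rparr>)" using cyc y by auto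
    next
      fix y assume "y \<in> \<Phi> n ` carrier ((Ch C n)\<lparr>carrier := cycles C n\<rparr>)"
      then obtain x where "x \<in> cycles C n" "y = \<Phi> n x" by auto
      then show "y \<in> carrier ((Ch D n)\<lparr>carrier := cycles D n\<rparr>)"
        using cyc[of x n] subsetD[OF sub(1)] by simp
    qed
  qed (use C D bnd sub in \<open>auto simp: subgroup_boundaries\<close>)
qed

section \<open>Direct sums of complexes\<close>

lemma chain_complex_sum:
  assumes C: "chain_complex C" and D: "chain_complex D"
  shows "chain_complex (sum_cplx C D)"
  unfolding chain_complex_def sum_cplx_def
proof (intro conjI allI ballI)
  fix n
  interpret C: comm_group "Ch C n" using C by (rule chain_complexD)
  interpret D: comm_group "Ch D n" using D by (rule chain_complexD)
  show "comm_group (Ch \<lparr>Ch = \<lambda>n. Ch C n \<times>\<times> Ch D n, Bd = \<lambda>n. map_prod (Bd C n) (Bd D n)\<rparr> n)"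
    using C.group_axioms D.group_axioms
    by (auto intro!: group.group_comm_groupI DirProd_group simp: C.m_comm D.m_comm)
qed (use chain_complexD(2,3)[OF C] chain_complexD(2,3)[OF D] in \<open>auto simp: hom_def Pi_iff\<close>)

text \<open>Cycles and boundaries of the sum are the products of those of the summands, and a
  quotient of a product by a product of subgroups splits.\<close>

lemma homology_sum:
  assumes C: "chain_complex C" and D: "chain_complex D"
  shows "homology (sum_cplx C D) n \<cong> homology C n \<times>\<times> homology D n"
proof -
  let ?G = "(Ch C n)\<lparr>carrier := cycles C n\<rparr>" and ?H = "(Ch D n)\<lparr>carrier := cycles D n\<rparr>"
  have "cycles (sum_cplx C D) n = cycles C n \<times> cycles D n"
    by (cases n) (auto simp: cycles_0 cycles_Suc kernel_def sum_cplx_def)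
  then have "(Ch (sum_cplx C D) n)\<lparr>carrier := cycles (sum_cplx C D) n\<rparr> = ?G \<times>\<times> ?H"
    by (simp add: sum_cplx_def DirProd_def)
  moreover have "boundaries (sum_cplx C D) n = boundaries C n \<times> boundaries D n"
    by (force simp: boundaries_def sum_cplx_def)
  ultimately have *: "homology (sum_cplx C D) n = ?G \<times>\<times> ?H Mod boundaries C n \<times> boundaries D n"
    by (simp add: homology_def)
  show ?thesis
    unfolding * unfolding homology_def
    using comm_group_cycles[OF C, of n] comm_group_cycles[OF D, of n]
    by (intro group.FactGroup_DirProd_multiplication_iso_2 comm_group.subgroup_imp_normal
        subgroup_boundaries C D) (auto simp: comm_group.axioms)
qed

text \<open>One function can serve as the boundary in all degrees, because a tuple carries its
  degree in its length.\<close>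

definition add_cplx :: "(nat \<Rightarrow> 'g::ab_group_add set) \<Rightarrow> ('g \<Rightarrow> 'g) \<Rightarrow> 'g cplx" where
  "add_cplx D b = \<lparr>Ch = (\<lambda>n. add_grp (D n)), Bd = (\<lambda>n. b)\<rparr>"

lemma add_cplx_simps [simp]: "Ch (add_cplx D b) n = add_grp (D n)" "Bd (add_cplx D b) n = b"
  by (simp_all add: add_cplx_def)

lemma chain_complex_add_cplx:
  assumes "\<And>n. add_sub (D n)" "\<And>x y. b (x + y) = b x + b y"
    and "\<And>n c. c \<in> D (Suc n) \<Longrightarrow> b c \<in> D n" "\<And>n c. c \<in> D (Suc (Suc n)) \<Longrightarrow> b (b c) = 0"
  shows "chain_complex (add_cplx D b)"
  unfolding chain_complex_def using assms by (auto intro!: homI)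

text \<open>
  The exact complex \<open>(D, b)\<close> splits as \<open>D\<^sub>n = Z\<^sub>n \<oplus> h Z\<^bsub>n-1\<^esub>\<close>, which determines the rank of the
  cycles \<open>Z\<^sub>n\<close>; multiplying the boundary by \<open>g\<close> keeps the cycles and replaces the boundaries
  \<open>Z\<^sub>n\<close> by \<open>g Z\<^sub>n\<close>.
\<close>

lemma homology_multiple_contractible:
  fixes D :: "nat \<Rightarrow> ('b \<Rightarrow>\<^sub>0 int) set"
  assumes rk: "\<And>n. free_rank (D n) (rk n)"
    and sub: "\<And>n M. add_sub M \<Longrightarrow> M \<subseteq> D n \<Longrightarrow> \<exists>k. free_rank M k"
    and b_add: "\<And>x y. b (x + y) = b x + b y" and b: "\<And>n c. c \<in> D (Suc n) \<Longrightarrow> b c \<in> D n"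
    and bb: "\<And>n c. c \<in> D (Suc (Suc n)) \<Longrightarrow> b (b c) = 0"
    and h_add: "\<And>x y. h (x + y) = h x + h y" and h: "\<And>n c. c \<in> D n \<Longrightarrow> h c \<in> D (Suc n)"
    and hb: "\<And>n c. c \<in> D (Suc n) \<Longrightarrow> b (h c) + h (b c) = c"
    and hb0: "\<And>c. c \<in> D 0 \<Longrightarrow> b (h c) = c"
    and B: "\<And>n c. c \<in> D (Suc n) \<Longrightarrow> b' c = frag_cmul g (b c)" and g: "g \<noteq> 0"
    and w: "w 0 = int (rk 0)" "\<And>n. w (Suc n) + w n = int (rk (Suc n))"
  shows "homology (add_cplx D b') n \<cong> Zmod_pow g (w n)"
proof -
  \<comment> \<open>In degree 0 every chain is a cycle, whatever value \<open>b\<close> takes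
    there.\<close>
  define Z where "Z n = {c \<in> D n. n = 0 \<or> b c = 0}" for n
  have D: "add_sub (D n)" for n using rk by (auto simp: free_rank_def)
  have b_diff: "b (x - y) = b x - b y" and h_diff: "h (x - y) = h x - h y" for x y
    using b_add[of "x - y" y] h_add[of "x - y" y] by simp_all
  have b_0: "b 0 = 0" and h_0: "h 0 = 0" using b_diff[of 0 0] h_diff[of 0 0] by simp_all
  have Z: "add_sub (Z n)" "Z n \<subseteq> D n" for n
    using D by (auto simp: Z_def add_sub_def b_diff b_0)
  \<comment> \<open>On cycles the homotopy identity reduces to b h = 1, so \<open>h\<close> is a
    section of \<open>b\<close> over the cycles; \<open>hb0\<close> supplies degree 0.\<close>
  have bh: "b (h z) = z" if "z \<in> Z n" for n z
    using that hb[of z "n - 1"] hb0 by (cases n) (auto simp: Z_def h_0)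
  have bZ: "b c \<in> Z n" if "c \<in> D (Suc n)" for n c
    using that b bb by (cases n) (auto simp: Z_def)
  have rank_Z: "\<exists>k. free_rank (Z n) k \<and> int k = w n" for n
  proof (induction n)
    case 0
    then show ?case using rk[of 0] w(1) by (auto simp: Z_def)
  next
    case (Suc n)
    then obtain k where k: "free_rank (Z n) k" "int k = w n" by blast
    obtain k' where k': "free_rank (Z (Suc n)) k'" using sub Z by blast
    have "add_sub (h ` Z n)"
      using Z(1)[of n] by (auto simp: add_sub_def h_0 simp flip: h_diff intro: image_eqI[of _ _ 0])
    moreover have "bij_betw h (Z n) (h ` Z n)"
      by (auto simp: bij_betw_def intro!: inj_on_inverseI[of _ b] bh)
    ultimately have hk: "free_rank (h ` Z n) k"
      using free_rank_iso[OF k(1)] h_add by blast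
    \<comment> \<open>If \<open>h z\<close> is a cycle, then applying \<open>b\<close> gives both 0
      and \<open>z\<close>.\<close>
    have "Z (Suc n) \<inter> h ` Z n = {0}"
    proof -
      have "x = 0" if "x \<in> Z (Suc n)" "x = h z" "z \<in> Z n" for x z
        using that bh[OF that(3)] h_0 by (auto simp: Z_def)
      then show ?thesis
        using add_sub_closed(1)[OF Z(1)] h_0 by (fastforce intro: image_eqI[of _ _ 0])
    qed
    moreover have "D (Suc n) = {x + y | x y. x \<in> Z (Suc n) \<and> y \<in> h ` Z n}"
    proof (intro equalityI subsetI)
      fix c assume c: "c \<in> D (Suc n)"
      have "h (b c) \<in> D (Suc n)" using b h c by blast
      then have "c - h (b c) \<in> Z (Suc n)"
        using c D bh[OF bZ[OF c]] by (auto simp: Z_def b_diff add_sub_closed)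
      moreover have "h (b c) \<in> h ` Z n" using bZ[OF c] by blast
      ultimately show "c \<in> {x + y | x y. x \<in> Z (Suc n) \<and> y \<in> h ` Z n}"
        by (intro CollectI exI[of _ "c - h (b c)"] exI[of _ "h (b c)"]) auto
    next
      fix c assume "c \<in> {x + y | x y. x \<in> Z (Suc n) \<and> y \<in> h ` Z n}"
      then show "c \<in> D (Suc n)" using Z(2) h D by (auto simp: subset_iff add_sub_closed)
    qed
    ultimately have "free_rank (D (Suc n)) (k' + k)" by (rule free_rank_plus[OF k' hk])
    \<comment> \<open>Computing the rank of \<open>D (Suc n)\<close> in two ways turns the
      decomposition into the recursion satisfied by \<open>w\<close>.\<close>
    then have "k' + k = rk (Suc n)" using rk free_rank_unique by blast
    then show ?case using k' k w(2)[of n] by (intro exI[of _ k']) auto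
  qed
  \<comment> \<open>Chain groups have no torsion and \<open>g\<close> is nonzero, so multiplying the
    boundary by \<open>g\<close> does not change its kernel.\<close>
  have "cycles (add_cplx D b') n = Z n"
    by (cases n) (auto simp: cycles_0 cycles_Suc Z_def kernel_def B g)
  moreover have "boundaries (add_cplx D b') n = frag_cmul g ` Z n"
  proof (intro equalityI subsetI)
    fix c assume "c \<in> frag_cmul g ` Z n"
    then obtain z where z: "z \<in> Z n" "c = frag_cmul g z" by blast
    then have "h z \<in> D (Suc n)" using Z h by blast
    then show "c \<in> boundaries (add_cplx D b') n"
      using z bh[OF z(1)] by (auto simp: boundaries_def B intro!: image_eqI[of _ _ "h z"])
  qed (use bZ in \<open>auto simp: boundaries_def B\<close>)
  ultimately have *: "homology (add_cplx D b') n = add_grp (Z n) Mod (frag_cmul g ` Z n)"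
    by (simp add: homology_def)
  obtain k where "free_rank (Z n) k" "int k = w n" using rank_Z by blast
  then show ?thesis
    unfolding * Zmod_pow_def using Mod_cmul_iso[of "Z n" k g] by (metis nat_int)
qed

lemma iso_trivial_kernel:
  assumes "group G" "group H" "f \<in> hom G H" "carrier H \<subseteq> f ` carrier G"
    and "\<And>x. x \<in> carrier G \<Longrightarrow> f x = \<one>\<^bsub>H\<^esub> \<Longrightarrow> x = \<one>\<^bsub>G\<^esub>"
  shows "f \<in> iso G H"
proof -
  interpret group_hom G H f
    using assms by (intro group_hom.intro group_hom_axioms.intro)
  show ?thesis
    using assms inj_on_one_iff hom_carrier[OF assms(3)] by (auto simp: iso_def bij_betw_def)
qed

section \<open>Subcomplexes and quotient complexes\<close>

definition subcplx :: "'g cplx \<Rightarrow> 'g cplx \<Rightarrow> bool" where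
  "subcplx S C \<longleftrightarrow>
     (\<forall>n. subgroup (carrier (Ch S n)) (Ch C n)) \<and>
     (\<forall>n. \<forall>c \<in> carrier (Ch S (Suc n)). Bd C (Suc n) c \<in> carrier (Ch S n))"

text \<open>\<open>subcplx\<close> constrains only the carriers of \<open>S\<close>, which is what
  \<open>quot_cplx\<close> reads. For \<open>S\<close> to be a complex in its own right, it must
  inherit operations and boundary from \<open>C\<close>.\<close>

lemma chain_complex_subcplx:
  assumes C: "chain_complex C" and S: "subcplx S C"
    and eq: "\<And>n. Ch S n = (Ch C n)\<lparr>carrier := carrier (Ch S n)\<rparr>" "Bd S = Bd C"
  shows "chain_complex S"
proof -
  have sub: "subgroup (carrier (Ch S n)) (Ch C n)" for n using S by (simp add: subcplx_def)
  have m: "c \<in> carrier (Ch C n)" if "c \<in> carrier (Ch S n)" for c n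
    using subgroup.subset[OF sub] that by blast
  have mult: "x \<otimes>\<^bsub>Ch S n\<^esub> y = x \<otimes>\<^bsub>Ch C n\<^esub> y" "\<one>\<^bsub>Ch S n\<^esub> = \<one>\<^bsub>Ch C n\<^esub>" for x y n
    by (subst eq, simp)+
  show ?thesis
    unfolding chain_complex_def
  proof (intro conjI allI ballI)
    fix n
    interpret comm_group "Ch C n" using C by (rule chain_complexD)
    have "group ((Ch C n)\<lparr>carrier := carrier (Ch S n)\<rparr>)"
      using sub by (rule subgroup.subgroup_is_group) (rule is_group)
    then show "comm_group (Ch S n)"
      unfolding eq(1)[symmetric]
      by (rule group.group_comm_groupI) (simp add: mult m m_comm)
    show "Bd S (Suc n) \<in> hom (Ch S (Suc n)) (Ch S n)"
      using S chain_complexD(2)[OF C, of n] unfolding eq(2)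
      by (intro homI) (auto simp: subcplx_def mult m hom_mult)
    show "Bd S (Suc n) (Bd S (Suc (Suc n)) c) = \<one>\<^bsub>Ch S n\<^esub>" if "c \<in> carrier (Ch S (Suc (Suc n)))" for c
      using chain_complexD(3)[OF C m[OF that]] by (simp add: eq(2) mult)
  qed
qed

context
  fixes C S :: "'g cplx"
  assumes C: "chain_complex C" and S: "subcplx S C"
begin

lemma subgroup_subcplx: "subgroup (carrier (Ch S n)) (Ch C n)"
  using S by (simp add: subcplx_def)

lemma normal_subcplx: "carrier (Ch S n) \<lhd> Ch C n"
  by (rule comm_group.subgroup_imp_normal[OF chain_complexD(1)[OF C] subgroup_subcplx])

lemma quot_proj_hom: "quot_proj C S n \<in> hom (Ch C n) (Ch (quot_cplx C S) n)"
  unfolding quot_cplx_def quot_proj_def using normal.r_coset_hom_Mod[OF normal_subcplx] by simp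

lemma quot_proj_onto: "quot_proj C S n ` carrier (Ch C n) = carrier (Ch (quot_cplx C S) n)"
  by (simp add: quot_cplx_def quot_proj_def carrier_FactGroup cong: image_cong)

lemma one_quot: "\<one>\<^bsub>Ch (quot_cplx C S) n\<^esub> = carrier (Ch S n)"
  by (simp add: quot_cplx_def)

lemma quot_proj_eq_one:
  assumes "c \<in> carrier (Ch C n)"
  shows "quot_proj C S n c = \<one>\<^bsub>Ch (quot_cplx C S) n\<^esub> \<longleftrightarrow> c \<in> carrier (Ch S n)"
  unfolding one_quot quot_proj_def
  using group.coset_join1[OF chain_complexD(4)[OF C] _ assms subgroup_subcplx]
    group.coset_join2[OF chain_complexD(4)[OF C] assms subgroup_subcplx]
    subgroup.subset[OF subgroup_subcplx] by blast

lemma comm_group_quot: "comm_group (Ch (quot_cplx C S) n)"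
  using comm_group.abelian_FactGroup[OF chain_complexD(1)[OF C] subgroup_subcplx]
  by (simp add: quot_cplx_def)

lemma quot_proj_mult_sub:
  assumes "c \<in> carrier (Ch C n)" "s \<in> carrier (Ch S n)"
  shows "quot_proj C S n (s \<otimes>\<^bsub>Ch C n\<^esub> c) = quot_proj C S n c"
proof -
  interpret Q: comm_group "Ch (quot_cplx C S) n" by (rule comm_group_quot)
  have s: "s \<in> carrier (Ch C n)" using assms subgroup.subset[OF subgroup_subcplx] by blast
  then show ?thesis
    using hom_mult[OF quot_proj_hom s assms(1)] quot_proj_eq_one[OF s] assms
      hom_in_carrier[OF quot_proj_hom] by simp
qed

text \<open>This justifies \<open>the_elem\<close> in \<open>quot_cplx\<close>: representatives of a
  coset differ by elements of \<open>S\<close>, whose boundaries lie in \<open>S\<close> again, so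
  all their boundaries fall into one coset.\<close>

lemma Bd_quot:
  assumes c: "c \<in> carrier (Ch C (Suc n))"
  shows "Bd (quot_cplx C S) (Suc n) (quot_proj C S (Suc n) c) = quot_proj C S n (Bd C (Suc n) c)"
proof -
  interpret Sn: subgroup "carrier (Ch S (Suc n))" "Ch C (Suc n)" by (rule subgroup_subcplx)
  interpret Cn: group "Ch C (Suc n)" by (rule chain_complexD[OF C])
  have "quot_proj C S n (Bd C (Suc n) (s \<otimes>\<^bsub>Ch C (Suc n)\<^esub> c)) = quot_proj C S n (Bd C (Suc n) c)"
    if s: "s \<in> carrier (Ch S (Suc n))" for s
    using s S hom_mult[OF chain_complexD(2)[OF C], of s n c] c Sn.mem_carrier[OF s]
      hom_in_carrier[OF chain_complexD(2)[OF C] c]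
    by (simp add: subcplx_def quot_proj_mult_sub)
  moreover have "quot_proj C S (Suc n) c =
      (\<lambda>s. s \<otimes>\<^bsub>Ch C (Suc n)\<^esub> c) ` carrier (Ch S (Suc n))"
    by (auto simp: quot_proj_def r_coset_def)
  ultimately have "(\<lambda>c. quot_proj C S n (Bd C (Suc n) c)) ` quot_proj C S (Suc n) c =
      {quot_proj C S n (Bd C (Suc n) c)}"
    by (auto simp: image_image intro!: image_eqI[OF _ Sn.one_closed])
  then show ?thesis by (simp add: quot_cplx_def)
qed

lemma chain_complex_quot: "chain_complex (quot_cplx C S)"
  unfolding chain_complex_def
proof (intro conjI allI ballI comm_group_quot)
  let ?q = "quot_proj C S" and ?Q = "quot_cplx C S"
  have rep: "\<exists>c \<in> carrier (Ch C n). x = ?q n c" if "x \<in> carrier (Ch ?Q n)" for x n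
    using that quot_proj_onto by blast
  note bd = hom_in_carrier[OF chain_complexD(2)[OF C]] and q = hom_in_carrier[OF quot_proj_hom]
  fix n
  show "Bd ?Q (Suc n) \<in> hom (Ch ?Q (Suc n)) (Ch ?Q n)"
  proof (rule homI)
    fix x assume "x \<in> carrier (Ch ?Q (Suc n))"
    then show "Bd ?Q (Suc n) x \<in> carrier (Ch ?Q n)"
      using rep Bd_quot bd q by (metis (no_types, lifting))
  next
    fix x y assume "x \<in> carrier (Ch ?Q (Suc n))" "y \<in> carrier (Ch ?Q (Suc n))"
    then obtain c c' where c: "c \<in> carrier (Ch C (Suc n))" "x = ?q (Suc n) c"
      "c' \<in> carrier (Ch C (Suc n))" "y = ?q (Suc n) c'"
      using rep by meson
    have xy: "?q (Suc n) c \<otimes>\<^bsub>Ch ?Q (Suc n)\<^esub> ?q (Suc n) c' = ?q (Suc n) (c \<otimes>\<^bsub>Ch C (Suc n)\<^esub> c')"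
      using c hom_mult[OF quot_proj_hom] by metis
    have cc: "c \<otimes>\<^bsub>Ch C (Suc n)\<^esub> c' \<in> carrier (Ch C (Suc n))"
      using c chain_complexD(4)[OF C] by (simp add: group.is_monoid monoid.m_closed)
    show "Bd ?Q (Suc n) (x \<otimes>\<^bsub>Ch ?Q (Suc n)\<^esub> y) =
        Bd ?Q (Suc n) x \<otimes>\<^bsub>Ch ?Q n\<^esub> Bd ?Q (Suc n) y"
      unfolding c(2,4) xy Bd_quot[OF c(1)] Bd_quot[OF c(3)] Bd_quot[OF cc] using c(1,3) bd
      by (simp add: hom_mult[OF chain_complexD(2)[OF C]] hom_mult[OF quot_proj_hom])
  qed
  fix x assume "x \<in> carrier (Ch ?Q (Suc (Suc n)))"
  then obtain c where c: "c \<in> carrier (Ch C (Suc (Suc n)))" "x = ?q (Suc (Suc n)) c"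
    using rep by meson
  then have "Bd ?Q (Suc n) (Bd ?Q (Suc (Suc n)) x) = ?q n \<one>\<^bsub>Ch C n\<^esub>"
    using bd chain_complexD(3)[OF C] by (simp add: Bd_quot)
  also have "\<dots> = \<one>\<^bsub>Ch ?Q n\<^esub>"
    using quot_proj_eq_one subgroup.one_closed[OF subgroup_subcplx]
      subgroup.subset[OF subgroup_subcplx] by blast
  finally show "Bd ?Q (Suc n) (Bd ?Q (Suc (Suc n)) x) = \<one>\<^bsub>Ch ?Q n\<^esub>" .
qed

end


section \<open>The operators on tuples\<close>

definition snoc :: "'a \<Rightarrow> ('a list \<Rightarrow>\<^sub>0 int) \<Rightarrow> ('a list \<Rightarrow>\<^sub>0 int)" where
  "snoc y = frag_extend (\<lambda>xs. frag_of (xs @ [y]))"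

definition frag_map :: "('a \<Rightarrow> 'a) \<Rightarrow> ('a list \<Rightarrow>\<^sub>0 int) \<Rightarrow> ('a list \<Rightarrow>\<^sub>0 int)" where
  "frag_map g = frag_extend (\<lambda>xs. frag_of (map g xs))"

text \<open>The operator \<kappa>. The sign depends on the length, hence on the degree, so that
  \<partial>\<kappa> + \<kappa>\<partial> becomes a translation without sign; \<open>snoc\<close> is
  the unsigned version.\<close>

definition cone :: "'a \<Rightarrow> ('a list \<Rightarrow>\<^sub>0 int) \<Rightarrow> ('a list \<Rightarrow>\<^sub>0 int)" where
  "cone y = frag_extend (\<lambda>xs. frag_cmul ((- 1) ^ length xs) (frag_of (xs @ [y])))"

text \<open>The projection r: it deletes the first entry and then applies s_0. Its value 0 on
  0-chains reflects that F^0 is zero in degree 0.\<close>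

definition retr :: "('a list \<Rightarrow>\<^sub>0 int) \<Rightarrow> ('a list \<Rightarrow>\<^sub>0 int)" where
  "retr = frag_extend (\<lambda>xs. if length xs \<le> 1 then 0 else frag_of (hd (tl xs) # tl xs))"

lemmas ops_defs = snoc_def frag_map_def cone_def retr_def s_zero_def bd_op_def

lemma ops_frag_of:
  "snoc y (frag_of xs) = frag_of (xs @ [y])"
  "frag_map g (frag_of xs) = frag_of (map g xs)"
  "cone y (frag_of xs) = frag_cmul ((- 1) ^ length xs) (frag_of (xs @ [y]))"
  "length xs \<le> 1 \<Longrightarrow> retr (frag_of xs) = 0"
  "length xs \<ge> 2 \<Longrightarrow> retr (frag_of xs) = frag_of (hd (tl xs) # tl xs)"
  "s_zero (frag_of xs) = frag_of (hd xs # xs)"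
  "bd_op f (frag_of xs) = bd_tuple f xs"
  by (simp_all add: ops_defs)

lemma ops_linear:
  "snoc y 0 = 0" "snoc y (c + c') = snoc y c + snoc y c'" "snoc y (c - c') = snoc y c - snoc y c'"
  "snoc y (frag_cmul n c) = frag_cmul n (snoc y c)"
  "frag_map g 0 = 0" "frag_map g (c + c') = frag_map g c + frag_map g c'"
  "frag_map g (c - c') = frag_map g c - frag_map g c'" "frag_map g (frag_cmul n c) = frag_cmul n (frag_map g c)"
  "cone y 0 = 0" "cone y (c + c') = cone y c + cone y c'" "cone y (c - c') = cone y c - cone y c'"
  "cone y (frag_cmul n c) = frag_cmul n (cone y c)"
  "retr 0 = 0" "retr (c + c') = retr c + retr c'" "retr (c - c') = retr c - retr c'"
  "retr (frag_cmul n c) = frag_cmul n (retr c)"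
  "s_zero 0 = 0" "s_zero (c + c') = s_zero c + s_zero c'" "s_zero (c - c') = s_zero c - s_zero c'"
  "s_zero (frag_cmul n c) = frag_cmul n (s_zero c)"
  "bd_op f 0 = 0" "bd_op f (c + c') = bd_op f c + bd_op f c'" "bd_op f (c - c') = bd_op f c - bd_op f c'"
  "bd_op f (frag_cmul n c) = frag_cmul n (bd_op f c)"
  by (simp_all add: ops_defs frag_extend_add frag_extend_diff frag_extend_cmul)

lemma bd_op_minus: "bd_op f (- c) = - bd_op f c"
  by (simp add: ops_defs frag_extend_minus)

lemma ops_sum:
  "finite I \<Longrightarrow> snoc y (sum c I) = (\<Sum>i\<in>I. snoc y (c i))"
  "finite I \<Longrightarrow> frag_map g (sum c I) = (\<Sum>i\<in>I. frag_map g (c i))"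
  by (simp_all add: ops_defs frag_extend_sum o_def)

lemma frag_cmul_diff_distrib2: "frag_cmul c (a - b) = frag_cmul c a - frag_cmul c b"
  by (metis frag_cmul_distrib2 diff_add_cancel add_diff_cancel)

section \<open>Boundary identities by way of the last entry\<close>

lemma bd_tuple_snoc:
  assumes "xs \<noteq> []"
  shows "bd_tuple f (xs @ [y]) =
    snoc y (bd_tuple f xs) + frag_cmul ((- 1) ^ length xs) (frag_of (map (\<lambda>x. f x y) xs))"
proof -
  obtain m where m: "length xs = Suc m" using assms by (cases xs) auto
  \<comment> \<open>The faces of index at most m leave the final entry \<open>y\<close> alone; the
    face of index m + 1 translates all of \<open>xs\<close> by \<open>y\<close>.\<close>
  have "(\<Sum>i = 1..m. frag_cmul ((- 1) ^ i)
      (frag_of (map (\<lambda>x. f x ((xs @ [y]) ! i)) (take i (xs @ [y])) @ drop (Suc i) (xs @ [y])))) =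
    (\<Sum>i = 1..m. snoc y (frag_cmul ((- 1) ^ i)
      (frag_of (map (\<lambda>x. f x (xs ! i)) (take i xs) @ drop (Suc i) xs))))"
    using m by (intro sum.cong) (auto simp: ops_linear ops_frag_of nth_append)
  moreover have "{1..Suc m} = insert (Suc m) {1..m}" by auto
  ultimately show ?thesis
    using m assms by (simp add: bd_tuple_def ops_linear ops_frag_of ops_sum nth_append)
qed

text \<open>Chains of degree n are supported on tuples of length n + 1. The identities are linear
  and only ask for a lower bound on the length, which suits induction over the support.\<close>

abbreviation longer :: "nat \<Rightarrow> 'a list set" where
  "longer n \<equiv> {xs. n \<le> length xs}"

lemma keys_bd_tuple:
  "xs \<noteq> [] \<Longrightarrow> ys \<in> Poly_Mapping.keys (bd_tuple f xs) \<Longrightarrow>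
    Suc (length ys) = length xs \<and> set ys \<subseteq> set xs \<union> (\<lambda>(x, y). f x y) ` (set xs \<times> set xs)"
proof -
  assume ne: "xs \<noteq> []" and "ys \<in> Poly_Mapping.keys (bd_tuple f xs)"
  then have "ys = tl xs \<or> (\<exists>i\<in>{1..length xs - 1}.
      ys = map (\<lambda>x. f x (xs ! i)) (take i xs) @ drop (Suc i) xs)"
    unfolding bd_tuple_def
    using keys_add keys_sum by (fastforce simp: keys_frag_of split: if_splits)
  then show ?thesis
  proof (elim disjE bexE)
    assume "ys = tl xs"
    then show ?thesis using ne by (auto dest: list.set_sel(2))
  next
    fix i assume i: "i \<in> {1..length xs - 1}"
      and ys: "ys = map (\<lambda>x. f x (xs ! i)) (take i xs) @ drop (Suc i) xs"
    have "xs ! i \<in> set xs" using i ne by (cases xs) auto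
    then show ?thesis using i ne ys set_take_subset[of i xs] set_drop_subset[of "Suc i" xs] by auto
  qed
qed

lemma cone_homogeneous:
  assumes "Poly_Mapping.keys c \<subseteq> {xs. length xs = n}"
  shows "cone y c = frag_cmul ((- 1) ^ n) (snoc y c)"
  using assms by (induction c rule: frag_induction)
    (simp_all add: ops_linear ops_frag_of frag_cmul_diff_distrib2)

text \<open>Lets an induction on the last entry treat the appended entry as a cone; the sign is its
  own inverse.\<close>

lemma frag_of_snoc: "frag_of (xs @ [y]) = frag_cmul ((- 1) ^ length xs) (cone y (frag_of xs))"
  by (simp add: ops_frag_of flip: power_add)

text \<open>
  \<open>bd_op f\<close> sends a 0-chain to a multiple of \<open>frag_of []\<close>, its augmentation; with this convention
  the next formula also holds in degree 0.
\<close>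

lemma bd_cone:
  assumes "Poly_Mapping.keys c \<subseteq> longer 1"
  shows "bd_op f (cone y c) = frag_map (\<lambda>x. f x y) c - cone y (bd_op f c)"
  using assms
proof (induction c rule: frag_induction)
  case (one xs)
  then have xs: "xs \<noteq> []" by auto
  then have "cone y (bd_tuple f xs) = frag_cmul ((- 1) ^ (length xs - 1)) (snoc y (bd_tuple f xs))"
    by (intro cone_homogeneous) (auto dest!: keys_bd_tuple[OF xs])
  \<comment> \<open>Boundaries are one entry shorter; this is the source of the minus sign before
    \<open>cone y (bd_op f c)\<close>.\<close>
  moreover have "(- 1 :: int) ^ length xs = - ((- 1) ^ (length xs - 1))"
    using xs by (cases xs) auto
  ultimately show ?case
    using xs by (simp add: ops_frag_of ops_linear bd_tuple_snoc frag_cmul_distrib2 flip: power_add)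
qed (simp_all add: ops_linear)

lemma frag_map_bd:
  assumes "Poly_Mapping.keys c \<subseteq> longer 1" and "\<And>x y. g (f x y) = f (g x) (g y)"
  shows "frag_map g (bd_op f c) = bd_op f (frag_map g c)"
  using assms(1)
proof (induction c rule: frag_induction)
  case (one xs)
  then have "map g (tl xs) = tl (map g xs)" by (simp add: map_tl)
  with one assms(2) show ?case
    by (auto simp: ops_frag_of ops_linear bd_tuple_def ops_sum take_map drop_map o_def intro!: sum.cong)
qed (simp_all add: ops_linear)

lemma keys_bd_op:
  assumes "Poly_Mapping.keys c \<subseteq> longer (Suc n)"
  shows "Poly_Mapping.keys (bd_op f c) \<subseteq> longer n"
proof
  fix ys assume "ys \<in> Poly_Mapping.keys (bd_op f c)"
  then obtain xs where "xs \<in> Poly_Mapping.keys c" "ys \<in> Poly_Mapping.keys (bd_tuple f xs)"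
    using keys_frag_extend[of "bd_tuple f" c] unfolding bd_op_def by blast
  moreover from this have "Suc n \<le> length xs" using assms by auto
  ultimately show "ys \<in> longer n" using keys_bd_tuple[of xs ys f] by (cases xs) auto
qed

text \<open>
  The identities below are proved by induction on the last entry of a tuple: up to sign, appending
  \<open>y\<close> is \<open>cone y\<close>, which \<open>bd_cone\<close> moves past \<open>bd_op f\<close>.
\<close>

lemma bd_bd:
  assumes "Poly_Mapping.keys c \<subseteq> longer 2"
    and fg: "\<And>x y z. g (f x y) z = f (g x z) (g y z)" "\<And>x y z. f (g x y) z = g (f x z) (f y z)"
  shows "bd_op f (bd_op g c) + bd_op g (bd_op f c) = 0"
  using assms(1)
proof (induction c rule: frag_induction)
  case (one xs)
  then show ?case
  proof (induction xs rule: rev_induct)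
    case (snoc y xs)
    show ?case
    \<comment> \<open>The boundary of a one-entry tuple is the empty tuple, to which
      \<open>bd_cone\<close> does not apply, so tuples with two entries are computed
      directly.\<close>
    proof (cases "length xs = 1")
      case True
      then obtain x where "xs = [x]" by (cases xs) auto
      then show ?thesis by (simp add: ops_frag_of ops_linear bd_tuple_def)
    next
      case False
      with snoc.prems have 2: "length xs \<ge> 2" by simp
      let ?c = "frag_of xs"
      have IH: "bd_op f (bd_op g ?c) + bd_op g (bd_op f ?c) = 0" using snoc.IH 2 by simp
      have c: "Poly_Mapping.keys ?c \<subseteq> longer 2" using 2 by (simp add: keys_frag_of)
      then have c1: "Poly_Mapping.keys ?c \<subseteq> longer 1" by auto
      have bc: "Poly_Mapping.keys (bd_op h ?c) \<subseteq> longer 1" for h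
        using keys_bd_op[of ?c 1 h] c by (simp add: numeral_2_eq_2)
      \<comment> \<open>Right translation by \<open>y\<close> for each operation is an endomorphism
        of the other one. Hence the four translation terms produced by \<open>bd_cone\<close> cancel
        in pairs and only the cone of the induction hypothesis remains.\<close>
      have m: "frag_map (\<lambda>x. g x y) (bd_op f ?c) = bd_op f (frag_map (\<lambda>x. g x y) ?c)"
        "frag_map (\<lambda>x. f x y) (bd_op g ?c) = bd_op g (frag_map (\<lambda>x. f x y) ?c)"
        by (rule frag_map_bd[OF c1], rule fg(1), rule frag_map_bd[OF c1], rule fg(2))
      have "bd_op f (bd_op g (cone y ?c)) + bd_op g (bd_op f (cone y ?c)) =
          cone y (bd_op f (bd_op g ?c) + bd_op g (bd_op f ?c))"
        by (simp add: bd_cone[OF c1] bd_cone[OF bc] ops_linear m)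
      then show ?thesis
        unfolding frag_of_snoc by (simp add: ops_linear IH flip: frag_cmul_distrib2)
    qed
  qed simp
next
  case (diff a b)
  have "bd_op f (bd_op g (a - b)) + bd_op g (bd_op f (a - b)) =
      (bd_op f (bd_op g a) + bd_op g (bd_op f a)) - (bd_op f (bd_op g b) + bd_op g (bd_op f b))"
    by (simp add: ops_linear)
  then show ?case using diff by simp
qed (simp add: ops_linear)

text \<open>r looks only at the first two entries and keeps the length, hence also the sign. For one
  entry this fails: r kills the tuple, but not the tuple extended by \<open>y\<close>.\<close>

lemma retr_cone:
  assumes "Poly_Mapping.keys c \<subseteq> longer 2"
  shows "retr (cone y c) = cone y (retr c)"
  using assms
proof (induction c rule: frag_induction)
  case (one xs)
  then obtain x x' zs where "xs = x # x' # zs" by (auto simp: numeral_2_eq_2 Suc_le_length_iff)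
  then show ?case by (simp add: ops_frag_of ops_linear)
qed (simp_all add: ops_linear)

lemma frag_map_retr: "frag_map g (retr c) = retr (frag_map g c)"
proof (rule frag_induction[of c UNIV])
  fix xs :: "'a list"
  show "frag_map g (retr (frag_of xs)) = retr (frag_map g (frag_of xs))"
    by (cases xs rule: remdups_adj.cases) (auto simp: ops_frag_of ops_linear)
qed (auto simp: ops_linear)

lemma bd_retr:
  assumes "Poly_Mapping.keys c \<subseteq> longer 2" and f: "\<And>x. f x x = x"
  shows "bd_op f (retr c) = retr (bd_op f c)"
  using assms(1)
proof (induction c rule: frag_induction)
  case (one xs)
  then show ?case
  proof (induction xs rule: rev_induct)
    case (snoc y xs)
    \<comment> \<open>Applying \<open>retr_cone\<close> to the boundary of \<open>xs\<close> takes
      three entries in \<open>xs\<close>, so there are two base cases. In the first, both sides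
      vanish: (y, y) has boundary 0 by idempotence, and r kills 0-chains.\<close>
    consider "length xs = 1" | "length xs = 2" | "length xs \<ge> 3"
      using snoc.prems by fastforce
    then show ?case
    proof cases
      case 1
      then obtain x where "xs = [x]" by (cases xs) auto
      then show ?thesis by (simp add: ops_frag_of ops_linear bd_tuple_def f)
    next
      case 2
      then obtain x x' where "xs = [x, x']"
        by (auto simp: numeral_2_eq_2 length_Suc_conv)
      moreover have "{1..Suc (Suc 0)} = {1, 2}" by auto
      ultimately show ?thesis by (simp add: ops_frag_of ops_linear bd_tuple_def f)
    next
      case 3
      let ?c = "frag_of xs"
      have IH: "bd_op f (retr ?c) = retr (bd_op f ?c)" using snoc.IH 3 by simp
      have c: "Poly_Mapping.keys ?c \<subseteq> longer 2" "Poly_Mapping.keys ?c \<subseteq> longer 1"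
        using 3 by (simp_all add: keys_frag_of)
      have bc: "Poly_Mapping.keys (bd_op f ?c) \<subseteq> longer 2"
        using keys_bd_op[of ?c 2 f] 3 by (simp add: keys_frag_of)
      have rc: "Poly_Mapping.keys (retr ?c) \<subseteq> longer 1" using 3 by (simp add: ops_frag_of keys_frag_of)
      have "bd_op f (retr (cone y ?c)) = retr (bd_op f (cone y ?c))"
        by (simp add: retr_cone[OF c(1)] bd_cone[OF rc] bd_cone[OF c(2)] ops_linear
            retr_cone[OF bc] frag_map_retr IH)
      then show ?thesis unfolding frag_of_snoc by (simp add: ops_linear)
    qed
  qed simp
qed (simp_all add: ops_linear)

text \<open>The first two faces of the doubled tuple cancel by idempotence, and its other faces
  cancel against \<open>s_zero\<close> of the faces of positive index. What remains is
  \<open>s_zero\<close> of the tuple without its first entry, which is r.\<close>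

lemma bd_s_zero:
  assumes "Poly_Mapping.keys c \<subseteq> longer 2" and f: "\<And>x. f x x = x"
  shows "bd_op f (s_zero c) + s_zero (bd_op f c) = retr c"
  using assms(1)
proof (induction c rule: frag_induction)
  case (one xs)
  then show ?case
  proof (induction xs rule: rev_induct)
    case (snoc y xs)
    show ?case
    proof (cases "length xs = 1")
      case True
      then obtain x where "xs = [x]" by (cases xs) auto
      moreover have "{1..Suc (Suc 0)} = {1, 2}" by auto
      ultimately show ?thesis by (simp add: ops_frag_of ops_linear bd_tuple_def f)
    next
      case False
      with snoc.prems have 2: "length xs \<ge> 2" by simp
      let ?c = "frag_of xs"
      have IH: "bd_op f (s_zero ?c) + s_zero (bd_op f ?c) = retr ?c" using snoc.IH 2 by simp
      have c: "Poly_Mapping.keys ?c \<subseteq> longer 2" "Poly_Mapping.keys ?c \<subseteq> longer 1"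
        using 2 by (simp_all add: keys_frag_of)
      have sc: "Poly_Mapping.keys (s_zero ?c) \<subseteq> longer 1" using 2 by (simp add: ops_frag_of keys_frag_of)
      \<comment> \<open>\<open>s_zero\<close> adds an entry, so the sign of the cone flips; this
        makes the translation terms cancel below.\<close>
      have sk: "s_zero (cone y c) = - cone y (s_zero c)" if "Poly_Mapping.keys c \<subseteq> longer 1" for c
        using that by (induction c rule: frag_induction) (auto simp: ops_frag_of ops_linear hd_append)
      have bc: "Poly_Mapping.keys (bd_op f ?c) \<subseteq> longer 1"
        using keys_bd_op[of ?c 1 f] 2 by (simp add: keys_frag_of)
      have sm: "s_zero (frag_map g ?c) = frag_map g (s_zero ?c)" for g
        using 2 by (cases xs) (simp_all add: ops_frag_of)
      have "bd_op f (s_zero (cone y ?c)) + s_zero (bd_op f (cone y ?c)) =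
          cone y (bd_op f (s_zero ?c) + s_zero (bd_op f ?c))"
        by (simp add: sk[OF c(2)] sk[OF bc] bd_cone[OF c(2)] bd_cone[OF sc] ops_linear sm bd_op_minus)
      also have "\<dots> = retr (cone y ?c)" by (simp add: IH retr_cone[OF c(1)])
      finally show ?thesis unfolding frag_of_snoc by (simp add: ops_linear flip: frag_cmul_distrib2)
    qed
  qed simp
next
  case (diff a b)
  then show ?case by (simp add: ops_linear algebra_simps)
qed (simp add: ops_linear)

section \<open>Chain groups and the operators on them\<close>

definition Cn :: "'a set \<Rightarrow> nat \<Rightarrow> ('a list \<Rightarrow>\<^sub>0 int) set" where
  "Cn X n = {c. Poly_Mapping.keys c \<subseteq> tuples X n}"

lemma add_sub_Cn [simp, intro]: "add_sub (Cn X n)"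
  unfolding Cn_def by (rule add_sub_keys)

lemma Cn_mono: "X \<subseteq> Y \<Longrightarrow> c \<in> Cn X n \<Longrightarrow> c \<in> Cn Y n"
  by (auto simp: Cn_def tuples_def)

lemma Cn_longer: "c \<in> Cn X n \<Longrightarrow> m \<le> Suc n \<Longrightarrow> Poly_Mapping.keys c \<subseteq> longer m"
  by (auto simp: Cn_def tuples_def)

lemma C_cplx_eq: "C_cplx a d X = add_cplx (Cn X) (bd_ad a d)"
  by (simp add: C_cplx_def add_cplx_def add_grp_def free_Abelian_group_def Cn_def)

text \<open>Reduces a membership claim to tuples. With \<open>M = {0}\<close> and a difference of
  linear maps for \<open>f\<close>, it proves that the two maps agree.\<close>

lemma Cn_linear:
  assumes "c \<in> Cn X n" "f 0 = 0" "\<And>x y. f (x - y) = f x - f y" "add_sub M"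
    and "\<And>xs. xs \<in> tuples X n \<Longrightarrow> f (frag_of xs) \<in> M"
  shows "f c \<in> M"
proof -
  have "Poly_Mapping.keys c \<subseteq> tuples X n" using assms(1) by (simp add: Cn_def)
  then show ?thesis
    by (induction c rule: frag_induction) (use assms in \<open>auto simp: add_sub_closed\<close>)
qed

lemma frag_of_Cn [simp]: "frag_of xs \<in> Cn X n \<longleftrightarrow> xs \<in> tuples X n"
  by (simp add: Cn_def keys_frag_of)

lemma bd_op_Cn:
  assumes "c \<in> Cn X (Suc n)" "\<And>x y. x \<in> X \<Longrightarrow> y \<in> X \<Longrightarrow> f x y \<in> X"
  shows "bd_op f c \<in> Cn X n"
proof (rule Cn_linear[OF assms(1)])
  fix xs assume xs: "xs \<in> tuples X (Suc n)"
  then have ne: "xs \<noteq> []" by (auto simp: tuples_def)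
  have "ys \<in> tuples X n" if "ys \<in> Poly_Mapping.keys (bd_tuple f xs)" for ys
    using keys_bd_tuple[OF ne that] xs assms(2) by (force simp: tuples_def)
  then show "bd_op f (frag_of xs) \<in> Cn X n" by (auto simp: ops_frag_of Cn_def)
qed (simp_all add: ops_linear)

lemma frag_map_Cn: "c \<in> Cn X n \<Longrightarrow> g ` X \<subseteq> Y \<Longrightarrow> frag_map g c \<in> Cn Y n"
  by (rule Cn_linear) (auto simp: ops_linear ops_frag_of tuples_def)

lemma retr_Cn:
  assumes "c \<in> Cn X n"
  shows "retr c \<in> Cn X n"
proof (rule Cn_linear[OF assms])
  fix xs assume xs: "xs \<in> tuples X n"
  show "retr (frag_of xs) \<in> Cn X n"
  proof (cases "length xs \<le> 1")
    case False
    then obtain x y zs where "xs = x # y # zs" by (cases xs rule: remdups_adj.cases) auto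
    then show ?thesis using xs by (simp add: ops_frag_of tuples_def)
  qed (simp add: ops_frag_of add_sub_closed)
qed (simp_all add: ops_linear)

lemma s_zero_Cn: "c \<in> Cn X n \<Longrightarrow> s_zero c \<in> Cn X (Suc n)"
proof (rule Cn_linear[where f = s_zero])
  fix xs assume "xs \<in> tuples X n"
  then show "s_zero (frag_of xs) \<in> Cn X (Suc n)" by (cases xs) (auto simp: ops_frag_of tuples_def)
qed (simp_all add: ops_linear)

lemma cone_Cn:
  assumes "c \<in> Cn X n" "y \<in> X"
  shows "cone y c \<in> Cn X (Suc n)"
  using assms(1)
proof (rule Cn_linear)
  fix xs assume "xs \<in> tuples X n"
  then show "cone y (frag_of xs) \<in> Cn X (Suc n)"
    using assms(2) by (auto simp: ops_frag_of tuples_def intro!: add_sub_cmul)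
qed (simp_all add: ops_linear)

lemma retr_retr: "retr (retr c) = retr c"
proof (rule frag_induction[of c UNIV])
  fix xs :: "'a list"
  show "retr (retr (frag_of xs)) = retr (frag_of xs)"
    by (cases xs rule: remdups_adj.cases) (auto simp: ops_frag_of ops_linear)
qed (auto simp: ops_linear)

lemma frag_map_const: "frag_map (\<lambda>_. t) (frag_map (\<lambda>_. t) c) = frag_map (\<lambda>_. t) c"
  by (rule frag_induction[of c UNIV]) (auto simp: ops_frag_of ops_linear o_def)

lemma frag_map_id [simp]: "frag_map (\<lambda>x. x) c = c"
  by (rule frag_induction[of c UNIV]) (auto simp: ops_frag_of ops_linear)

lemma frag_map_const_Cn: "c \<in> Cn {t} n \<Longrightarrow> frag_map (\<lambda>_. t) c = c"
proof -
  assume "c \<in> Cn {t} n"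
  then have "frag_map (\<lambda>_. t) c - c \<in> {0}"
    by (rule Cn_linear) (auto simp: ops_linear ops_frag_of tuples_def add_sub_def intro!: arg_cong[where f = frag_of] map_idI)
  then show ?thesis by simp
qed

lemma retr_Cn_0: "c \<in> Cn X 0 \<Longrightarrow> retr c = 0"
proof -
  assume "c \<in> Cn X 0"
  then have "retr c \<in> {0}"
    by (rule Cn_linear) (auto simp: ops_linear ops_frag_of tuples_def add_sub_def)
  then show ?thesis by simp
qed

text \<open>So the complex of the point lies in F^0 in positive degrees. In degree 0 it does not,
  which is why the rank computations treat that degree separately.\<close>

lemma retr_Cn_point:
  assumes "c \<in> Cn {t} (Suc n)"
  shows "retr c = c"
proof -
  have "retr c - c \<in> {0}"
  proof (rule Cn_linear[OF assms])
    fix xs assume xs: "xs \<in> tuples {t} (Suc n)"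
    then obtain x y zs where "xs = x # y # zs" by (cases xs rule: remdups_adj.cases) (auto simp: tuples_def)
    then show "retr (frag_of xs) - frag_of xs \<in> {0}" using xs by (auto simp: ops_frag_of tuples_def)
  qed (simp_all add: ops_linear add_sub_def)
  then show ?thesis by simp
qed

section \<open>The boundary with coefficients \<open>a\<close> and \<open>d\<close>\<close>

lemma op_idem [simp]: "op_zero x x = x" "op_sim x x = x"
  by (simp_all add: op_zero_def op_sim_def)

lemma bd_ad_lin:
  "bd_ad a d 0 = 0" "bd_ad a d (c + c') = bd_ad a d c + bd_ad a d c'"
  "bd_ad a d (c - c') = bd_ad a d c - bd_ad a d c'"
  "bd_ad a d (frag_cmul n c) = frag_cmul n (bd_ad a d c)"
  by (simp_all add: bd_ad_def ops_linear frag_cmul_distrib2 frag_cmul_diff_distrib2 ac_simps)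

lemma bd_ad_cmul: "bd_ad (g * a) (g * d) c = frag_cmul g (bd_ad a d c)"
  by (simp add: bd_ad_def frag_cmul_distrib2)

lemma bd_ad_Cn: "c \<in> Cn X (Suc n) \<Longrightarrow> bd_ad a d c \<in> Cn X n"
  unfolding bd_ad_def
  by (intro add_sub_closed(4)[OF add_sub_Cn] add_sub_cmul add_sub_Cn bd_op_Cn)
    (auto simp: op_zero_def op_sim_def)

lemma bd_ad_bd_ad:
  assumes "Poly_Mapping.keys c \<subseteq> longer 2"
  shows "bd_ad a d (bd_ad a d c) = 0"
proof -
  \<comment> \<open>With both operations equal, \<open>bd_bd\<close> says that twice the square
    vanishes, and chains have no torsion.\<close>
  have 1: "bd_op f (bd_op f c) = 0" if "\<And>x y z. f (f x y) z = f (f x z) (f y z)" for f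
  proof -
    have "bd_op f (bd_op f c) + bd_op f (bd_op f c) = 0"
      by (rule bd_bd[OF assms]; rule that)
    then have "frag_cmul 2 (bd_op f (bd_op f c)) = 0"
      using frag_cmul_distrib[of 1 1 "bd_op f (bd_op f c)"] by simp
    then show ?thesis by simp
  qed
  have 2: "bd_op op_zero (bd_op op_zero c) = 0" "bd_op op_sim (bd_op op_sim c) = 0"
    by (rule 1; simp add: op_zero_def op_sim_def)+
  have "bd_op op_zero (bd_op op_sim c) + bd_op op_sim (bd_op op_zero c) = 0"
    by (rule bd_bd[OF assms]; simp add: op_zero_def op_sim_def)
  then have 3: "bd_op op_sim (bd_op op_zero c) = - bd_op op_zero (bd_op op_sim c)"
    by (metis add.commute minus_unique)
  have 4: "frag_cmul k (- x) = frag_cmul (- k) x" for k and x :: "'a list \<Rightarrow>\<^sub>0 int"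
    using frag_cmul_diff_distrib2[of k 0 x] by simp
  show ?thesis
    by (simp add: bd_ad_def ops_linear frag_cmul_distrib2 2 3 4 mult.commute flip: frag_cmul_distrib)
qed

text \<open>Right translation by \<open>t\<close> is the identity for \<open>op_zero\<close> and
  constant for \<open>op_sim\<close>; these give the two terms on the right.\<close>

lemma bd_ad_cone:
  assumes "Poly_Mapping.keys c \<subseteq> longer 1"
  shows "bd_ad a d (cone t c) + cone t (bd_ad a d c) =
    frag_cmul a c + frag_cmul d (frag_map (\<lambda>_. t) c)"
  by (simp add: bd_ad_def bd_cone[OF assms] ops_linear op_zero_def op_sim_def frag_cmul_diff_distrib2)

lemma bd_ad_s_zero:
  assumes "Poly_Mapping.keys c \<subseteq> longer 2"
  shows "bd_ad a d (s_zero c) + s_zero (bd_ad a d c) = frag_cmul (a + d) (retr c)"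
proof -
  have "bd_op f (s_zero c) = retr c - s_zero (bd_op f c)" if "\<And>x. f x x = x" for f
    using bd_s_zero[OF assms, of f, simplified that] by (simp add: algebra_simps)
  from this[of op_zero] this[of op_sim] show ?thesis
    by (simp add: bd_ad_def ops_linear frag_cmul_diff_distrib2 frag_cmul_distrib)
qed

lemma bd_ad_retr:
  assumes "Poly_Mapping.keys c \<subseteq> longer 2"
  shows "bd_ad a d (retr c) = retr (bd_ad a d c)"
  by (simp add: bd_ad_def bd_retr[OF assms] ops_linear)

lemma bd_ad_frag_map_const:
  assumes "Poly_Mapping.keys c \<subseteq> longer 1"
  shows "bd_ad a d (frag_map (\<lambda>_. t) c) = frag_map (\<lambda>_. t) (bd_ad a d c)"
  by (simp add: bd_ad_def ops_linear frag_map_bd[OF assms])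


section \<open>The splitting\<close>

text \<open>F^0 is described by the fixed points of r, so that maps commuting with r visibly
  preserve it; \<open>Fn_0\<close> and \<open>Fn_Suc\<close> recover the description as an image of
  s_0.\<close>

definition Fn :: "'a set \<Rightarrow> nat \<Rightarrow> ('a list \<Rightarrow>\<^sub>0 int) set" where
  "Fn X n = {c \<in> Cn X n. retr c = c}"

text \<open>Deleting the first entry is a left inverse.\<close>

lemma s_zero_eq_0: "Poly_Mapping.keys c \<subseteq> longer 1 \<Longrightarrow> s_zero c = 0 \<Longrightarrow> c = 0"
proof -
  define tail :: "('a list \<Rightarrow>\<^sub>0 int) \<Rightarrow> _" where "tail = frag_extend (\<lambda>xs. frag_of (tl xs))"
  assume "Poly_Mapping.keys c \<subseteq> longer 1"
  then have "tail (s_zero c) = c"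
    by (induction c rule: frag_induction) (simp_all add: tail_def ops_frag_of ops_linear frag_extend_diff)
  then show "s_zero c = 0 \<Longrightarrow> c = 0" by (simp add: tail_def)
qed

lemma Fn_0: "Fn X 0 = {0}"
  using retr_Cn_0 add_sub_closed(1)[OF add_sub_Cn] by (fastforce simp: Fn_def ops_linear)

lemma Fn_Suc: "Fn X (Suc n) = s_zero ` Cn X n"
proof (intro equalityI subsetI)
  fix c assume "c \<in> Fn X (Suc n)"
  then have c: "c \<in> Cn X (Suc n)" "retr c = c" by (auto simp: Fn_def)
  \<comment> \<open>Deletion of the first entry followed by s_0 is r, so a fixed chain
    \<open>c\<close> of r is s_0 of \<open>tail c\<close>.\<close>
  define tail :: "('a list \<Rightarrow>\<^sub>0 int) \<Rightarrow> _" where "tail = frag_extend (\<lambda>xs. frag_of (tl xs))"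
  have "tail c \<in> Cn X n"
    using c(1)
  proof (rule Cn_linear[where f = tail])
    fix xs assume "xs \<in> tuples X (Suc n)"
    then show "tail (frag_of xs) \<in> Cn X n" by (cases xs) (auto simp: tail_def tuples_def)
  qed (simp_all add: tail_def frag_extend_diff)
  moreover have "Poly_Mapping.keys c \<subseteq> longer 2" using Cn_longer[OF c(1)] by simp
  then have "s_zero (tail c) = retr c"
    by (induction c rule: frag_induction) (simp_all add: tail_def ops_frag_of ops_linear frag_extend_diff)
  ultimately show "c \<in> s_zero ` Cn X n" using c(2) by (metis imageI)
next
  fix c assume "c \<in> s_zero ` Cn X n"
  then obtain x where x: "x \<in> Cn X n" "c = s_zero x" by blast
  have "Poly_Mapping.keys x \<subseteq> longer 1" using Cn_longer[OF x(1)] by simp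
  then have "retr (s_zero x) = s_zero x"
    by (induction x rule: frag_induction) (auto simp: ops_frag_of ops_linear Suc_le_length_iff)
  then show "c \<in> Fn X (Suc n)" using x s_zero_Cn by (simp add: Fn_def)
qed

lemma carrier_F_cplx: "carrier (Ch (F_cplx a d X) n) = Fn X n"
  by (cases n) (simp_all add: F_cplx_def C_cplx_eq Fn_0 Fn_Suc)

lemma add_sub_Fn [simp, intro]: "add_sub (Fn X n)"
  using add_sub_Cn[of X n] by (simp add: Fn_def add_sub_def ops_linear)

lemma bd_ad_Fn:
  assumes "c \<in> Fn X (Suc n)"
  shows "bd_ad a d c \<in> Fn X n"
proof -
  have c: "c \<in> Cn X (Suc n)" "retr c = c" using assms by (auto simp: Fn_def)
  then show ?thesis using bd_ad_retr[OF Cn_longer[OF c(1)], of a d] bd_ad_Cn[OF c(1)] by (simp add: Fn_def)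
qed

lemma bd_ad_bd_ad_Cn: "c \<in> Cn X (Suc (Suc n)) \<Longrightarrow> bd_ad a d (bd_ad a d c) = 0"
  by (intro bd_ad_bd_ad Cn_longer) auto

lemma chain_complex_C: "chain_complex (C_cplx a d X)"
  unfolding C_cplx_eq
  by (rule chain_complex_add_cplx) (auto simp: bd_ad_lin intro: bd_ad_Cn bd_ad_bd_ad_Cn)

section \<open>The commuting projections and their images\<close>

locale splitting_data =
  fixes X :: "'a set" and t :: 'a and a d :: int
  assumes t: "t \<in> X"
begin

abbreviation eps where "eps \<equiv> frag_map (\<lambda>_. t)"

definition piF where "piF c = retr c - eps (retr c)"
definition piN where "piN c = (c - retr c) - eps (c - retr c)"

text \<open>\<open>K\<close> and \<open>N\<close> are the images of \<open>piF\<close> and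
  \<open>piN\<close>. They serve as models inside C(X) for the reduced degenerate and the reduced
  normalized complex, which avoids calculating with cosets.\<close>

definition K where "K n = {c \<in> Cn X n. retr c = c \<and> eps c = 0}"
definition N where "N n = {c \<in> Cn X n. retr c = 0 \<and> eps c = 0}"

lemma pi_lin:
  "piF 0 = 0" "piF (c + c') = piF c + piF c'" "piF (c - c') = piF c - piF c'"
  "piF (frag_cmul n c) = frag_cmul n (piF c)"
  "piN 0 = 0" "piN (c + c') = piN c + piN c'" "piN (c - c') = piN c - piN c'"
  "piN (frag_cmul n c) = frag_cmul n (piN c)"
  by (simp_all add: piF_def piN_def ops_linear frag_cmul_diff_distrib2)

lemma decomposition: "c = eps c + piF c + piN c"
  by (simp add: piF_def piN_def ops_linear)

lemma eps_Cn: "c \<in> Cn X n \<Longrightarrow> eps c \<in> Cn {t} n"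
  using frag_map_Cn[of c X n "\<lambda>_. t" "{t}"] by auto

lemma Cn_point: "c \<in> Cn {t} n \<Longrightarrow> c \<in> Cn X n"
  using t by (auto intro: Cn_mono)

lemma eps_CnX: "c \<in> Cn X n \<Longrightarrow> eps c \<in> Cn X n"
  by (rule Cn_point[OF eps_Cn])

lemma eps_eps: "eps (eps c) = eps c"
  by (rule frag_map_const)

lemma eps_retr: "retr (eps c) = eps (retr c)"
  by (simp add: frag_map_retr)

lemma piF_K: "c \<in> Cn X n \<Longrightarrow> piF c \<in> K n"
  by (simp add: piF_def K_def ops_linear eps_eps eps_retr retr_retr retr_Cn eps_CnX
      add_sub_closed(2)[OF add_sub_Cn])

lemma piN_N: "c \<in> Cn X n \<Longrightarrow> piN c \<in> N n"
  by (simp add: piN_def N_def ops_linear eps_eps eps_retr retr_retr retr_Cn eps_CnX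
      add_sub_closed(2)[OF add_sub_Cn])

lemma K_Cn: "c \<in> K n \<Longrightarrow> c \<in> Cn X n" and N_Cn: "c \<in> N n \<Longrightarrow> c \<in> Cn X n"
  by (auto simp: K_def N_def)

lemma K_Fn: "c \<in> K n \<Longrightarrow> c \<in> Fn X n"
  by (auto simp: K_def Fn_def)

lemma piF_eq: "c \<in> K n \<Longrightarrow> piF c = c" and piN_eq: "c \<in> N n \<Longrightarrow> piN c = c"
  and piN_K: "c \<in> K n \<Longrightarrow> piN c = 0" and piF_N: "c \<in> N n \<Longrightarrow> piF c = 0"
  by (auto simp: K_def N_def piF_def piN_def ops_linear)

lemma pi_point:
  assumes "c \<in> Cn {t} n"
  shows "piF c = 0" "piN c = 0"
proof -
  have "eps c = c" using assms by (rule frag_map_const_Cn)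
  then show "piF c = 0" "piN c = 0"
    using eps_retr[of c] by (simp_all add: piF_def piN_def ops_linear)
qed

lemma eps_piF: "eps (piF c) = 0" and eps_piN: "eps (piN c) = 0"
  by (simp_all add: piF_def piN_def ops_linear eps_eps)

lemma pi_Fn:
  assumes "c \<in> Fn X n"
  shows "piF c = c - eps c" "piN c = 0"
  using assms by (simp_all add: Fn_def piF_def piN_def ops_linear)

text \<open>The coefficients are arbitrary because the contractions concern the divided boundaries,
  with coefficients a/g and d/g on \<open>K\<close> and with 1 and 0 on \<open>N\<close>.\<close>

lemma bd_ad_pi:
  assumes "c \<in> Cn X (Suc n)"
  shows "bd_ad a' d' (eps c) = eps (bd_ad a' d' c)" "bd_ad a' d' (piF c) = piF (bd_ad a' d' c)"
    "bd_ad a' d' (piN c) = piN (bd_ad a' d' c)"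
  using bd_ad_retr[OF Cn_longer[OF assms], of a' d'] bd_ad_frag_map_const[OF Cn_longer[OF assms], of a' d' t]
    bd_ad_frag_map_const[OF Cn_longer[OF retr_Cn[OF assms]], of a' d' t]
  by (simp_all add: piF_def piN_def bd_ad_lin ops_linear)

lemma add_sub_K [simp, intro]: "add_sub (K n)" and add_sub_N [simp, intro]: "add_sub (N n)"
  using add_sub_Cn[of X n] by (simp_all add: K_def N_def add_sub_def ops_linear)

lemma bd_ad_K: "c \<in> K (Suc n) \<Longrightarrow> bd_ad a' d' c \<in> K n" and bd_ad_N: "c \<in> N (Suc n) \<Longrightarrow> bd_ad a' d' c \<in> N n"
  using bd_ad_pi[of c n a' d'] piF_K[of "bd_ad a' d' c" n] piN_N[of "bd_ad a' d' c" n]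
  by (simp_all add: K_Cn N_Cn bd_ad_Cn piF_eq piN_eq)

lemma chain_complex_K: "chain_complex (add_cplx K (bd_ad a d))"
  by (rule chain_complex_add_cplx) (auto simp: bd_ad_lin bd_ad_K dest: K_Cn intro: bd_ad_bd_ad_Cn)

lemma chain_complex_N: "chain_complex (add_cplx N (bd_ad a d))"
  by (rule chain_complex_add_cplx) (auto simp: bd_ad_lin bd_ad_N dest: N_Cn intro: bd_ad_bd_ad_Cn)

section \<open>Comparison with the quotient complexes\<close>

abbreviation "CX \<equiv> C_cplx a d X"
abbreviation "CT \<equiv> C_cplx a d {t}"
abbreviation "CR \<equiv> C_rel a d X t"
abbreviation "FR \<equiv> F_red a d X t"
abbreviation "CN \<equiv> CeN_red a d X t"
abbreviation "q \<equiv> quot_proj CX CT"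
abbreviation "p \<equiv> quot_proj CR FR"

lemma C_simps [simp]:
  "Ch (C_cplx a d Y) n = add_grp (Cn Y n)" "Bd (C_cplx a d Y) n = bd_ad a d"
  by (simp_all add: C_cplx_eq)

lemma subcplx_T: "subcplx CT CX"
  unfolding subcplx_def using Cn_point by (auto simp: bd_ad_Cn)

lemma CR_eq: "CR = quot_cplx CX CT"
  by (simp add: C_rel_def)

lemmas q_hom = quot_proj_hom[OF chain_complex_C subcplx_T, folded CR_eq]
  and q_onto = quot_proj_onto[OF chain_complex_C subcplx_T, folded CR_eq, simplified]
  and q_eq_one = quot_proj_eq_one[OF chain_complex_C subcplx_T, folded CR_eq, simplified]
  and q_add = quot_proj_mult_sub[OF chain_complex_C subcplx_T, simplified]
  and q_bd = Bd_quot[OF chain_complex_C subcplx_T, folded CR_eq, simplified]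
  and chain_complex_CR = chain_complex_quot[OF chain_complex_C subcplx_T, folded CR_eq]

lemma q_mult: "c \<in> Cn X n \<Longrightarrow> c' \<in> Cn X n \<Longrightarrow> q n (c + c') = q n c \<otimes>\<^bsub>Ch CR n\<^esub> q n c'"
  using hom_mult[OF q_hom, of c n c'] by simp

lemma FR_simps: "Ch FR n = (Ch CR n)\<lparr>carrier := q n ` Fn X n\<rparr>" "carrier (Ch FR n) = q n ` Fn X n"
  "Bd FR = Bd CR"
  by (simp_all add: F_red_def carrier_F_cplx)

lemma Fn_Cn: "c \<in> Fn X n \<Longrightarrow> c \<in> Cn X n"
  by (simp add: Fn_def)

lemma subcplx_F: "subcplx FR CR"
  unfolding subcplx_def FR_simps(2)
proof (intro conjI allI ballI)
  fix n
  interpret q: group_hom "Ch CX n" "Ch CR n" "q n"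
    using q_hom chain_complexD(4)[OF chain_complex_C] chain_complexD(4)[OF chain_complex_CR]
    by (intro group_hom.intro group_hom_axioms.intro)
  show "subgroup (q n ` Fn X n) (Ch CR n)"
    by (rule q.subgroup_img_is_subgroup) (auto simp: Fn_Cn)
  fix x assume "x \<in> q (Suc n) ` Fn X (Suc n)"
  then obtain c where c: "c \<in> Fn X (Suc n)" "x = q (Suc n) c" by blast
  then have "Bd CR (Suc n) x = q n (bd_ad a d c)" using q_bd Fn_Cn by simp
  then show "Bd CR (Suc n) x \<in> q n ` Fn X n" using bd_ad_Fn[OF c(1)] by simp
qed

lemma chain_complex_FR: "chain_complex FR"
  by (rule chain_complex_subcplx[OF chain_complex_CR subcplx_F]) (simp_all add: FR_simps)

lemma CN_eq: "CN = quot_cplx CR FR"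
  by (simp add: CeN_red_def)

lemmas p_hom = quot_proj_hom[OF chain_complex_CR subcplx_F, folded CN_eq]
  and p_onto = quot_proj_onto[OF chain_complex_CR subcplx_F, folded CN_eq]
  and p_one = quot_proj_eq_one[OF chain_complex_CR subcplx_F, folded CN_eq]
  and p_bd = Bd_quot[OF chain_complex_CR subcplx_F, folded CN_eq]
  and chain_complex_CN = chain_complex_quot[OF chain_complex_CR subcplx_F, folded CN_eq]

lemma q_carrier: "c \<in> Cn X n \<Longrightarrow> q n c \<in> carrier (Ch CR n)"
  by (rule hom_in_carrier[OF q_hom]) simp

lemma q_piF: "c \<in> Fn X n \<Longrightarrow> q n (piF c) = q n c"
proof -
  assume c: "c \<in> Fn X n"
  have "q n (eps c + piF c) = q n (piF c)"
    using c by (intro q_add) (auto intro: eps_Cn Fn_Cn K_Cn piF_K)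
  then show ?thesis using pi_Fn[OF c] by simp
qed

text \<open>Of the two parts that \<open>piN\<close> discards, \<open>eps c\<close> vanishes in the
  relative complex and \<open>piF c\<close> in the second quotient.\<close>

lemma pq_piN:
  assumes c: "c \<in> Cn X n"
  shows "p n (q n (piN c)) = p n (q n c)"
proof -
  have F: "piF c \<in> Fn X n" using c by (intro K_Fn piF_K)
  have N: "piN c \<in> Cn X n" using N_Cn[OF piN_N[OF c]] .
  have sum: "piF c + piN c \<in> Cn X n" using F N by (simp add: add_sub_closed Fn_Cn)
  have "q n c = q n (eps c + (piF c + piN c))" using decomposition[of c] by (simp add: add.assoc)
  also have "\<dots> = q n (piF c + piN c)"
    using sum c by (intro q_add) (auto intro: eps_Cn)
  also have "\<dots> = q n (piF c) \<otimes>\<^bsub>Ch CR n\<^esub> q n (piN c)"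
    using F N by (simp add: q_mult Fn_Cn)
  finally show ?thesis
    using quot_proj_mult_sub[OF chain_complex_CR subcplx_F q_carrier[OF N], of "q n (piF c)"] F
    by (simp add: FR_simps(2))
qed

lemma K_point: "c \<in> K n \<Longrightarrow> c \<in> Cn {t} n \<Longrightarrow> c = 0"
  using piF_eq[of c n] pi_point(1)[of c n] by simp

text \<open>A chain that dies in the normalized complex has the same coset as some \<open>f\<close>
  in F^0; then \<open>c - f\<close> is a chain of the point, and \<open>piN\<close> kills both
  \<open>f\<close> and \<open>c - f\<close>.\<close>

lemma pq_eq_one:
  assumes "c \<in> Cn X n"
  shows "p n (q n c) = \<one>\<^bsub>Ch CN n\<^esub> \<longleftrightarrow> piN c = 0"
proof
  assume "p n (q n c) = \<one>\<^bsub>Ch CN n\<^esub>"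
  then have "q n c \<in> q n ` Fn X n"
    using p_one[OF q_carrier[OF assms]] by (simp add: FR_simps)
  then obtain f where f: "f \<in> Fn X n" "q n c = q n f" by blast
  have cf: "c - f \<in> Cn X n" using assms f Fn_Cn by (simp add: add_sub_closed)
  interpret R: group "Ch CR n" by (rule chain_complexD[OF chain_complex_CR])
  have "q n (c - f) \<otimes>\<^bsub>Ch CR n\<^esub> q n f = q n f"
    using q_mult[OF cf Fn_Cn[OF f(1)]] f(2) by simp
  then have "q n (c - f) = \<one>\<^bsub>Ch CR n\<^esub>"
    using q_carrier[OF cf] q_carrier[OF Fn_Cn[OF f(1)]] by (simp add: R.l_cancel_one')
  then have "c - f \<in> Cn {t} n" using q_eq_one[OF cf] by blast
  then show "piN c = 0"
    using pi_point(2) pi_Fn(2)[OF f(1)] pi_lin(7)[of c f] by simp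
next
  assume "piN c = 0"
  then have "p n (q n c) = p n (q n 0)" using pq_piN[OF assms] by simp
  moreover have "q n 0 = \<one>\<^bsub>Ch CR n\<^esub>" using q_eq_one[of 0 n] by (simp add: add_sub_closed)
  ultimately show "p n (q n c) = \<one>\<^bsub>Ch CN n\<^esub>"
    using hom_one[OF p_hom] chain_complexD(4) chain_complex_CR chain_complex_CN by metis
qed

lemma one_FR: "\<one>\<^bsub>Ch FR n\<^esub> = \<one>\<^bsub>Ch CR n\<^esub>" and mult_FR: "x \<otimes>\<^bsub>Ch FR n\<^esub> y = x \<otimes>\<^bsub>Ch CR n\<^esub> y"
  by (simp_all add: FR_simps)

lemma pq_mult:
  "c \<in> Cn X n \<Longrightarrow> c' \<in> Cn X n \<Longrightarrow> p n (q n (c + c')) = p n (q n c) \<otimes>\<^bsub>Ch CN n\<^esub> p n (q n c')"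
  using hom_mult[OF p_hom q_carrier q_carrier] by (simp add: q_mult)

lemma pq_carrier: "c \<in> Cn X n \<Longrightarrow> p n (q n c) \<in> carrier (Ch CN n)"
  by (rule hom_in_carrier[OF p_hom q_carrier])

lemma pq_rep:
  assumes "y \<in> carrier (Ch CN n)"
  obtains c where "c \<in> Cn X n" "y = p n (q n c)"
proof -
  from assms obtain z where "z \<in> carrier (Ch CR n)" "y = p n z" unfolding p_onto[symmetric] by blast
  moreover from this obtain c where "c \<in> Cn X n" "z = q n c" unfolding q_onto[symmetric] by blast
  ultimately show thesis using that by blast
qed

text \<open>Onto because \<open>f\<close> and \<open>piF f\<close> differ by a chain of the point;
  injective because \<open>K\<close> meets the chains of the point only in 0.\<close>

lemma chain_iso_FR: "chain_iso (add_cplx K (bd_ad a d)) FR q"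
  unfolding chain_iso_def
proof (intro conjI allI ballI)
  fix n
  show "q n \<in> iso (Ch (add_cplx K (bd_ad a d)) n) (Ch FR n)"
  proof (rule iso_trivial_kernel)
    show "q n \<in> hom (Ch (add_cplx K (bd_ad a d)) n) (Ch FR n)"
      by (rule homI) (auto simp: FR_simps(2) mult_FR K_Fn K_Cn q_mult)
    show "carrier (Ch FR n) \<subseteq> q n ` carrier (Ch (add_cplx K (bd_ad a d)) n)"
    proof
      fix y assume "y \<in> carrier (Ch FR n)"
      then obtain f where "f \<in> Fn X n" "y = q n f" by (auto simp: FR_simps(2))
      then show "y \<in> q n ` carrier (Ch (add_cplx K (bd_ad a d)) n)"
        using q_piF piF_K[OF Fn_Cn] by (intro image_eqI[of _ _ "piF f"]) auto
    qed
    show "c = \<one>\<^bsub>Ch (add_cplx K (bd_ad a d)) n\<^esub>"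
      if "c \<in> carrier (Ch (add_cplx K (bd_ad a d)) n)" "q n c = \<one>\<^bsub>Ch FR n\<^esub>" for c
      using that K_point q_eq_one[OF K_Cn] by (auto simp: one_FR)
  qed (rule chain_complexD(4)[OF chain_complex_K] chain_complexD(4)[OF chain_complex_FR])+
  show "q n (Bd (add_cplx K (bd_ad a d)) (Suc n) c) = Bd FR (Suc n) (q (Suc n) c)"
    if "c \<in> carrier (Ch (add_cplx K (bd_ad a d)) (Suc n))" for c
    using that by (simp add: FR_simps(3) q_bd K_Cn)
qed

lemma pq_bd: "c \<in> Cn X (Suc n) \<Longrightarrow> Bd CN (Suc n) (p (Suc n) (q (Suc n) c)) = p n (q n (bd_ad a d c))"
  by (simp add: p_bd q_carrier q_bd)

text \<open>Onto because \<open>piN c\<close> represents the same class as \<open>c\<close>;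
  injective because \<open>piN\<close> is the identity on \<open>N\<close>.\<close>

lemma chain_iso_CN: "chain_iso (add_cplx N (bd_ad a d)) CN (\<lambda>n c. p n (q n c))"
  unfolding chain_iso_def
proof (intro conjI allI ballI)
  fix n
  show "(\<lambda>c. p n (q n c)) \<in> iso (Ch (add_cplx N (bd_ad a d)) n) (Ch CN n)"
  proof (rule iso_trivial_kernel)
    show "(\<lambda>c. p n (q n c)) \<in> hom (Ch (add_cplx N (bd_ad a d)) n) (Ch CN n)"
      by (rule homI) (auto simp: N_Cn pq_mult pq_carrier)
    show "carrier (Ch CN n) \<subseteq> (\<lambda>c. p n (q n c)) ` carrier (Ch (add_cplx N (bd_ad a d)) n)"
    proof
      fix y assume "y \<in> carrier (Ch CN n)"
      then obtain c where "c \<in> Cn X n" "y = p n (q n c)" by (rule pq_rep)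
      then show "y \<in> (\<lambda>c. p n (q n c)) ` carrier (Ch (add_cplx N (bd_ad a d)) n)"
        using pq_piN piN_N by (intro image_eqI[of _ _ "piN c"]) auto
    qed
    show "c = \<one>\<^bsub>Ch (add_cplx N (bd_ad a d)) n\<^esub>"
      if "c \<in> carrier (Ch (add_cplx N (bd_ad a d)) n)" "p n (q n c) = \<one>\<^bsub>Ch CN n\<^esub>" for c
      using that pq_eq_one[OF N_Cn, of c n] piN_eq[of c n] by simp
  qed (rule chain_complexD(4)[OF chain_complex_N] chain_complexD(4)[OF chain_complex_CN])+
  show "p n (q n (Bd (add_cplx N (bd_ad a d)) (Suc n) c)) = Bd CN (Suc n) (p (Suc n) (q (Suc n) c))"
    if "c \<in> carrier (Ch (add_cplx N (bd_ad a d)) (Suc n))" for c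
    using that by (simp add: pq_bd N_Cn)
qed

definition \<Phi> where "\<Phi> n c = (eps c, q n (piF c), p n (q n (piN c)))"

lemma \<Phi>_iso: "\<Phi> n \<in> iso (Ch CX n) (Ch (sum_cplx CT (sum_cplx FR CN)) n)"
proof (rule iso_trivial_kernel)
  have S: "Ch (sum_cplx CT (sum_cplx FR CN)) n = Ch CT n \<times>\<times> (Ch FR n \<times>\<times> Ch CN n)"
    by (simp add: sum_cplx_def)
  show "group (Ch (sum_cplx CT (sum_cplx FR CN)) n)"
    by (intro chain_complexD chain_complex_sum chain_complex_C chain_complex_FR chain_complex_CN)
  show "\<Phi> n \<in> hom (Ch CX n) (Ch (sum_cplx CT (sum_cplx FR CN)) n)"
    unfolding S
    by (rule homI) (auto simp: \<Phi>_def FR_simps(2) mult_FR pi_lin ops_linear eps_Cn K_Cn N_Cn piF_K piN_N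
        q_mult[OF K_Cn K_Cn] pq_mult[OF N_Cn N_Cn] pq_carrier K_Fn)
  show "carrier (Ch (sum_cplx CT (sum_cplx FR CN)) n) \<subseteq> \<Phi> n ` carrier (Ch CX n)"
  proof
    fix y assume "y \<in> carrier (Ch (sum_cplx CT (sum_cplx FR CN)) n)"
    then obtain e f z where y: "y = (e, q n f, z)" "e \<in> Cn {t} n" "f \<in> Fn X n" "z \<in> carrier (Ch CN n)"
      by (auto simp: S FR_simps(2))
    obtain c where c: "c \<in> Cn X n" "z = p n (q n c)" using y(4) by (rule pq_rep)
    \<comment> \<open>The sum of one representative from each summand; each projection keeps its own
      term and kills the other two.\<close>
    let ?x = "e + piF f + piN c"
    have F: "piF f \<in> K n" and N: "piN c \<in> N n" using y c by (auto intro: piF_K piN_N Fn_Cn)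
    have "?x \<in> Cn X n" using y F N by (auto intro!: add_sub_closed(4) intro: Cn_point K_Cn N_Cn)
    moreover have "\<Phi> n ?x = y"
      using frag_map_const_Cn[OF y(2)] pi_point[OF y(2)] q_piF[OF y(3)] pq_piN[OF c(1)]
      by (simp add: \<Phi>_def ops_linear pi_lin eps_piF eps_piN piF_eq[OF F] piF_N[OF N] piN_K[OF F]
          piN_eq[OF N] y(1) c(2))
    ultimately show "y \<in> \<Phi> n ` carrier (Ch CX n)" by auto
  qed
  fix c assume c: "c \<in> carrier (Ch CX n)" and "\<Phi> n c = \<one>\<^bsub>Ch (sum_cplx CT (sum_cplx FR CN)) n\<^esub>"
  then have "eps c = 0" "q n (piF c) = \<one>\<^bsub>Ch CR n\<^esub>" "p n (q n (piN c)) = \<one>\<^bsub>Ch CN n\<^esub>"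
    by (auto simp: S \<Phi>_def one_FR)
  moreover from this have "piF c = 0"
    using c K_point[OF piF_K] q_eq_one[OF K_Cn[OF piF_K]] by auto
  moreover have "piN c = 0"
    using c calculation pq_eq_one[OF N_Cn[OF piN_N]] piN_eq[OF piN_N] by auto
  ultimately show "c = \<one>\<^bsub>Ch CX n\<^esub>" using decomposition[of c] by simp
qed (rule chain_complexD(4)[OF chain_complex_C])

lemma splitting_\<Phi>: "splitting a d X t \<Phi>"
  unfolding splitting_def chain_iso_def
proof (intro conjI allI ballI \<Phi>_iso)
  fix n
  show "\<Phi> n (Bd CX (Suc n) c) = Bd (sum_cplx CT (sum_cplx FR CN)) (Suc n) (\<Phi> (Suc n) c)"
    if "c \<in> carrier (Ch CX (Suc n))" for c
    using that by (simp add: \<Phi>_def sum_cplx_def FR_simps(3) bd_ad_pi q_bd pq_bd K_Cn N_Cn piF_K piN_N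
        flip: bd_ad_pi)
  have one: "q n 0 = \<one>\<^bsub>Ch CR n\<^esub>" "p n \<one>\<^bsub>Ch CR n\<^esub> = \<one>\<^bsub>Ch CN n\<^esub>"
    using q_eq_one[of 0 n] pq_eq_one[of 0 n] by (simp_all add: add_sub_closed pi_lin)
  show "\<Phi> n c = (c, \<one>\<^bsub>Ch FR n\<^esub>, \<one>\<^bsub>Ch CN n\<^esub>)" if "c \<in> carrier (Ch CT n)" for c
    using that by (simp add: \<Phi>_def one_FR one pi_point frag_map_const_Cn)
  show "snd (\<Phi> n c) = (q n c, \<one>\<^bsub>Ch CN n\<^esub>)" if "c \<in> carrier (Ch (F_cplx a d X) n)" for c
    using that by (simp add: \<Phi>_def carrier_F_cplx q_piF pi_Fn(2) one)
  show "snd (snd (\<Phi> n c)) = p n (q n c)" if "c \<in> carrier (Ch CX n)" for c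
    using that by (simp add: \<Phi>_def pq_piN)
qed

end


section \<open>Ranks and homology of the summands\<close>

text \<open>Every face for \<open>op_sim\<close> deletes or overwrites the first entry, the only one
  that r changes. Since r is 0 on \<open>N\<close>, this boundary vanishes there in positive
  degrees.\<close>

lemma bd_op_sim_retr:
  assumes "Poly_Mapping.keys c \<subseteq> longer 2"
  shows "bd_op op_sim (retr c) = bd_op op_sim c"
  using assms
proof (induction c rule: frag_induction)
  case (one xs)
  then obtain x y zs where xs: "xs = x # y # zs" by (auto simp: numeral_2_eq_2 Suc_le_length_iff)
  have "bd_tuple op_sim (y # y # zs) = bd_tuple op_sim (x # y # zs)"
    unfolding bd_tuple_def op_sim_def
    by (intro arg_cong2[where f = "(+)"] sum.cong) (auto simp: nth_Cons' map_replicate_const)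
  then show ?case by (simp add: xs ops_frag_of)
qed (simp_all add: ops_linear)

lemma card_tuples: "finite X \<Longrightarrow> card (tuples X n) = card X ^ Suc n"
  and finite_tuples: "finite X \<Longrightarrow> finite (tuples X n)"
  using card_lists_length_eq[of X "Suc n"] finite_lists_length_eq[of X "Suc n"]
  by (simp_all add: tuples_def conj_commute)

lemma free_rank_Cn: "finite X \<Longrightarrow> free_rank (Cn X n) (card X ^ Suc n)"
  unfolding Cn_def card_tuples[symmetric] by (intro free_rank_keys finite_tuples)

lemma free_rank_sub_Cn: "finite X \<Longrightarrow> add_sub M \<Longrightarrow> M \<subseteq> Cn X n \<Longrightarrow> \<exists>k. free_rank M k"
  by (rule free_rank_subgroup[OF finite_tuples, of X _ n]) (auto simp: Cn_def)

lemma free_rank_Fn: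
  assumes "finite X"
  shows "free_rank (Fn X (Suc n)) (card X ^ Suc n)"
proof (rule free_rank_iso[OF free_rank_Cn[OF assms]])
  have "x = y" if "x \<in> Cn X n" "y \<in> Cn X n" "s_zero x = s_zero y" for x y
    using that s_zero_eq_0[of "x - y"] Cn_longer[of "x - y" X n 1] add_sub_closed(2)[OF add_sub_Cn, of x X n y]
    by (simp add: ops_linear)
  then show "bij_betw s_zero (Cn X n) (Fn X (Suc n))"
    by (auto simp: bij_betw_def inj_on_def Fn_Suc)
qed (simp_all add: ops_linear)

section \<open>Ranks and contractions of the two reduced summands\<close>

context splitting_data
begin

text \<open>In positive degree F^0 is the direct sum of the rank one group of the point and
  \<open>K n\<close>; in degree 0 it vanishes.\<close>

lemma rank_K:
  assumes "finite X"
  obtains k where "free_rank (K n) k" "int k = (if n = 0 then 0 else int (card X) ^ n - 1)"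
proof -
  obtain k where k: "free_rank (K n) k"
    using free_rank_sub_Cn[OF assms add_sub_K subsetI[OF K_Cn]] by blast
  have "int k = (if n = 0 then 0 else int (card X) ^ n - 1)"
  proof (cases n)
    case 0
    have "c = 0" if "c \<in> K n" for c using K_Fn[OF that] by (simp add: 0 Fn_0)
    then have "K n = {0}" using add_sub_closed(1)[OF add_sub_K[of n]] by auto
    then show ?thesis using free_rank_unique[OF k] free_rank_trivial 0 by auto
  next
    case (Suc m)
    have P: "free_rank (Cn {t} n) 1" using free_rank_Cn[of "{t}" n] by simp
    have PF: "c \<in> Fn X n" if "c \<in> Cn {t} n" for c
      using that retr_Cn_point Cn_point by (auto simp: Fn_def Suc)
    have "Cn {t} n \<inter> K n = {0}"
      using K_point[of _ n] add_sub_closed(1)[OF add_sub_K[of n]]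
        add_sub_closed(1)[OF add_sub_Cn[of "{t}" n]] by blast
    moreover have "Fn X n = {x + y | x y. x \<in> Cn {t} n \<and> y \<in> K n}"
    proof (intro equalityI subsetI)
      fix c assume c: "c \<in> Fn X n"
      have "c = eps c + piF c" using pi_Fn[OF c] by simp
      then show "c \<in> {x + y | x y. x \<in> Cn {t} n \<and> y \<in> K n}"
        using eps_Cn[OF Fn_Cn[OF c]] piF_K[OF Fn_Cn[OF c]] by blast
    qed (auto intro!: add_sub_closed(4)[OF add_sub_Fn] intro: PF K_Fn)
    ultimately have "free_rank (Fn X n) (1 + k)" by (rule free_rank_plus[OF P k])
    then have "1 + k = card X ^ n" using free_rank_Fn[OF assms, of m] free_rank_unique Suc by blast
    then have "1 + int k = int (card X) ^ n" by (metis of_nat_1 of_nat_add of_nat_power)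
    then show ?thesis using Suc by simp
  qed
  with k show thesis by (rule that)
qed

lemma rank_N:
  assumes "finite X"
  obtains k where "free_rank (N n) k"
    "int k = int (card X) ^ Suc n - (if n = 0 then 1 else int (card X) ^ n)"
proof -
  obtain k where k: "free_rank (N n) k"
    using free_rank_sub_Cn[OF assms add_sub_N subsetI[OF N_Cn]] by blast
  \<comment> \<open>\<open>G\<close> is the sum of the chains of the point and F^0: in positive
    degree F^0 contains the former, in degree 0 it is zero. \<open>N n\<close> is a complement of
    \<open>G\<close>.\<close>
  define G where "G = (if n = 0 then Cn {t} n else Fn X n)"
  have G: "free_rank G (if n = 0 then 1 else card X ^ n)"
    using free_rank_Cn[of "{t}" n] free_rank_Fn[OF assms, of "n - 1"] by (cases n) (simp_all add: G_def)
  have sub_G: "add_sub G" by (simp add: G_def)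
  have GX: "c \<in> Cn X n" if "c \<in> G" for c using that Cn_point Fn_Cn by (auto simp: G_def split: if_splits)
  have piN_G: "piN c = 0" if "c \<in> G" for c
    using that pi_point pi_Fn by (auto simp: G_def split: if_splits)
  have "eps c + piF c \<in> G" if c: "c \<in> Cn X n" for c
  proof (cases n)
    case 0
    then have "piF c = 0" using c retr_Cn_0[of c X] by (simp add: piF_def ops_linear)
    then show ?thesis using 0 eps_Cn[OF c] by (simp add: G_def)
  next
    case (Suc m)
    then have "eps c \<in> Fn X n"
      using eps_Cn[OF c] eps_CnX[OF c] retr_Cn_point by (auto simp: Fn_def)
    then show ?thesis using Suc K_Fn[OF piF_K[OF c]] by (simp add: G_def add_sub_closed)
  qed
  then have "c \<in> {x + y | x y. x \<in> G \<and> y \<in> N n}" if "c \<in> Cn X n" for c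
    using decomposition[of c] piN_N[OF that] that by blast
  then have "Cn X n = {x + y | x y. x \<in> G \<and> y \<in> N n}"
    by (auto intro!: add_sub_closed(4)[OF add_sub_Cn] intro: GX N_Cn)
  moreover have "c = 0" if "c \<in> G" "c \<in> N n" for c
    using piN_G[OF that(1)] piN_eq[OF that(2)] by simp
  then have "G \<inter> N n = {0}"
    using add_sub_closed(1)[OF sub_G] add_sub_closed(1)[OF add_sub_N[of n]] by blast
  ultimately have "free_rank (Cn X n) ((if n = 0 then 1 else card X ^ n) + k)"
    using free_rank_plus[OF G k] by blast
  then have "(if n = 0 then 1 else card X ^ n) + k = card X ^ Suc n"
    using free_rank_Cn[OF assms] free_rank_unique by blast
  then have "(if n = 0 then 1 else int (card X) ^ n) + int k = int (card X) ^ Suc n"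
    by (auto simp flip: of_nat_power of_nat_add of_nat_Suc of_nat_mult split: if_splits)
  then have "int k = int (card X) ^ Suc n - (if n = 0 then 1 else int (card X) ^ n)"
    by linarith
  with k show thesis by (rule that)
qed

lemma homology_K:
  assumes "finite X" and ad: "a \<noteq> 0 \<or> d \<noteq> 0"
  shows "homology (add_cplx K (bd_ad a d)) n \<cong>
    Zmod_pow (gcd a d) (if even n then u (card X) n - 1 else u (card X) n)"
proof -
  define g where "g = gcd a d"
  have g: "g \<noteq> 0" using ad by (simp add: g_def)
  obtain a' d' where ad': "a = g * a'" "d = g * d'"
    unfolding g_def by (meson dvdE gcd_dvd1 gcd_dvd2)
  obtain v w where "v * a + w * d = g"
    unfolding g_def using bezout_int by blast
  then have "g * (v * a' + w * d') = g * 1" by (simp add: ad' algebra_simps)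
  then have "v * a' + w * d' = 1" using g by (metis mult_left_cancel)
  \<comment> \<open>On \<open>K\<close> the projection \<open>eps\<close> is 0 and r is the
    identity, so \<open>cone t\<close> contributes a' and \<open>s_zero\<close> contributes a' + d'.
    The weights v - w and w bring the Bezout relation into this shape.\<close>
  then have vw: "(v - w) * a' + w * (a' + d') = 1" by (simp add: algebra_simps)
  define h where "h c = piF (frag_cmul (v - w) (cone t c) + frag_cmul w (s_zero c))" for c
  have "\<exists>k. free_rank (K n) k \<and> int k = (if n = 0 then 0 else int (card X) ^ n - 1)" for n
    using rank_K[OF assms(1)] by metis
  then obtain rk where rk: "\<And>n. free_rank (K n) (rk n)"
    "\<And>n. int (rk n) = (if n = 0 then 0 else int (card X) ^ n - 1)"
    by metis
  \<comment> \<open>\<open>K 0\<close> is zero, so contracting degree 0 is trivial.\<close>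
  have K0: "c = 0" if "c \<in> K 0" for c using K_Fn[OF that] by (simp add: Fn_0)
  have inner: "frag_cmul (v - w) (cone t c) + frag_cmul w (s_zero c) \<in> Cn X (Suc n)"
    if "c \<in> Cn X n" for c n
    using that t by (intro add_sub_closed(4)[OF add_sub_Cn] add_sub_cmul add_sub_Cn cone_Cn s_zero_Cn)
  have "homology (add_cplx K (bd_ad a d)) n \<cong>
      Zmod_pow g ((\<lambda>n. if even n then u (card X) n - 1 else u (card X) n) n)"
  proof (rule homology_multiple_contractible[where rk = rk and b = "bd_ad a' d'" and h = h])
    show "\<exists>k. free_rank M k" if "add_sub M" "M \<subseteq> K n" for n M
      using that(2) K_Cn by (intro free_rank_sub_Cn[OF assms(1) that(1), of n] subsetI) (auto dest: subsetD)
    show "bd_ad a' d' (bd_ad a' d' c) = 0" if "c \<in> K (Suc (Suc n))" for n c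
      using bd_ad_bd_ad_Cn[OF K_Cn[OF that]] .
    show "h (x + y) = h x + h y" for x y
      by (simp add: h_def ops_linear pi_lin frag_cmul_distrib2)
    show "h c \<in> K (Suc n)" if "c \<in> K n" for n c
      unfolding h_def by (intro piF_K inner K_Cn that)
    show "bd_ad a' d' (h c) = c" if "c \<in> K 0" for c
      using K0[OF that] by (simp add: h_def ops_linear pi_lin bd_ad_lin)
    show "bd_ad a' d' (h c) + h (bd_ad a' d' c) = c" if c: "c \<in> K (Suc n)" for n c
    proof -
      have l: "Poly_Mapping.keys c \<subseteq> longer 1" "Poly_Mapping.keys c \<subseteq> longer 2"
        using Cn_longer[OF K_Cn[OF c]] by simp_all
      have "bd_ad a' d' (h c) + h (bd_ad a' d' c) =
          piF (frag_cmul (v - w) (bd_ad a' d' (cone t c) + cone t (bd_ad a' d' c)) +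
            frag_cmul w (bd_ad a' d' (s_zero c) + s_zero (bd_ad a' d' c)))"
        unfolding h_def bd_ad_pi(2)[OF inner[OF K_Cn[OF c]]]
        by (simp add: bd_ad_lin pi_lin frag_cmul_distrib2 ac_simps)
      also have "\<dots> = piF (frag_cmul ((v - w) * a' + w * (a' + d')) c)"
        unfolding bd_ad_cone[OF l(1)] bd_ad_s_zero[OF l(2)]
          frag_cmul_distrib[of "(v - w) * a'" "w * (a' + d')"]
        using c by (simp add: K_def)
      finally show ?thesis by (simp add: vw piF_eq[OF c])
    qed
  qed (use rk g in \<open>auto simp: bd_ad_lin bd_ad_K ad' bd_ad_cmul\<close>)
  then show ?thesis by (simp add: g_def)
qed

lemma homology_N:
  assumes "finite X" "a \<noteq> 0"
  shows "homology (add_cplx N (bd_ad a d)) n \<cong>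
    Zmod_pow a (u (card X) (n + 1) - u (card X) n + (- 1) ^ n)"
proof -
  define h where "h c = piN (cone t c)" for c
  have "\<exists>k. free_rank (N n) k \<and>
      int k = int (card X) ^ Suc n - (if n = 0 then 1 else int (card X) ^ n)" for n
    using rank_N[OF assms(1)] by metis
  then obtain rk where rk: "\<And>n. free_rank (N n) (rk n)"
    "\<And>n. int (rk n) = int (card X) ^ Suc n - (if n = 0 then 1 else int (card X) ^ n)"
    by metis
  show ?thesis
  proof (rule homology_multiple_contractible[where rk = rk and b = "bd_ad 1 0" and h = h
        and w = "\<lambda>n. u (card X) (n + 1) - u (card X) n + (- 1) ^ n"])
    show "\<exists>k. free_rank M k" if "add_sub M" "M \<subseteq> N n" for n M
      using that(2) N_Cn by (intro free_rank_sub_Cn[OF assms(1) that(1), of n] subsetI) (auto dest: subsetD)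
    show "bd_ad 1 0 (bd_ad 1 0 c) = 0" if "c \<in> N (Suc (Suc n))" for n c
      using bd_ad_bd_ad_Cn[OF N_Cn[OF that]] .
    show "h (x + y) = h x + h y" for x y
      by (simp add: h_def ops_linear pi_lin)
    show "h c \<in> N (Suc n)" if "c \<in> N n" for n c
      unfolding h_def by (intro piN_N cone_Cn N_Cn that t)
    \<comment> \<open>For one entry x the boundary of the cone is (x) - (t), and \<open>piN\<close>
      kills (t).\<close>
    show "bd_ad 1 0 (h c) = c" if c: "c \<in> N 0" for c
    proof -
      have "piN (bd_ad 1 0 (cone t c)) - piN c \<in> {0}"
      proof (rule Cn_linear[OF N_Cn[OF c]])
        fix xs assume "xs \<in> tuples X 0"
        then obtain x where "xs = [x]" by (auto simp: tuples_def length_Suc_conv)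
        moreover have "piN (frag_of [t]) = 0"
          using pi_point(2)[of "frag_of [t]" 0] by (simp add: tuples_def)
        ultimately show "piN (bd_ad 1 0 (cone t (frag_of xs))) - piN (frag_of xs) \<in> {0}"
          by (simp add: bd_ad_def bd_op_minus ops_frag_of ops_linear bd_tuple_def op_zero_def pi_lin)
      qed (simp_all add: ops_linear bd_ad_lin pi_lin add_sub_def)
      then show ?thesis
        unfolding h_def bd_ad_pi(3)[OF cone_Cn[OF N_Cn[OF c] t]] using piN_eq[OF c] by simp
    qed
    show "bd_ad 1 0 (h c) + h (bd_ad 1 0 c) = c" if c: "c \<in> N (Suc n)" for n c
    proof -
      have "bd_ad 1 0 (h c) + h (bd_ad 1 0 c) = piN (bd_ad 1 0 (cone t c) + cone t (bd_ad 1 0 c))"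
        unfolding h_def bd_ad_pi(3)[OF cone_Cn[OF N_Cn[OF c] t]] by (simp add: pi_lin)
      also have "bd_ad 1 0 (cone t c) + cone t (bd_ad 1 0 c) = c"
        using bd_ad_cone[of c 1 0 t] Cn_longer[OF N_Cn[OF c]] by simp
      finally show ?thesis by (simp add: piN_eq[OF c])
    qed
    \<comment> \<open>The \<open>op_sim\<close> part depends only on r c, which is 0 on
      \<open>N\<close>.\<close>
    show "bd_ad a d c = frag_cmul a (bd_ad 1 0 c)" if c: "c \<in> N (Suc n)" for n c
    proof -
      have "bd_op op_sim c = bd_op op_sim (retr c)"
        using bd_op_sim_retr[of c] Cn_longer[OF N_Cn[OF c]] by simp
      then show ?thesis using c by (simp add: bd_ad_def N_def ops_linear)
    qed
  qed (use rk assms in \<open>auto simp: bd_ad_lin bd_ad_N\<close>)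
qed

lemma homology_FR: "homology FR n \<cong> homology (add_cplx K (bd_ad a d)) n"
  by (rule group.iso_sym[OF group_homology[OF chain_complex_K]
        homology_chain_iso[OF chain_complex_K chain_complex_FR chain_iso_FR]])

lemma homology_CN: "homology CN n \<cong> homology (add_cplx N (bd_ad a d)) n"
  by (rule group.iso_sym[OF group_homology[OF chain_complex_N]
        homology_chain_iso[OF chain_complex_N chain_complex_CN chain_iso_CN]])

text \<open>The last two factors are interchanged to match the order in the final formulas.\<close>

lemma homology_CX: "homology CX n \<cong> homology CT n \<times>\<times> (homology CN n \<times>\<times> homology FR n)"
proof -
  note C = chain_complex_C chain_complex_FR chain_complex_CN
  have "homology CX n \<cong> homology (sum_cplx CT (sum_cplx FR CN)) n"
    using splitting_\<Phi> unfolding splitting_def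
    by (intro homology_chain_iso[OF C(1) chain_complex_sum[OF C(1) chain_complex_sum[OF C(2,3)]]]) blast
  also have "\<dots> \<cong> homology CT n \<times>\<times> homology (sum_cplx FR CN) n"
    by (intro homology_sum chain_complex_sum C)
  also have "\<dots> \<cong> homology CT n \<times>\<times> (homology CN n \<times>\<times> homology FR n)"
    by (intro group.DirProd_iso_trans group_homology C iso_refl
        iso_trans[OF homology_sum[OF C(2,3)] DirProd_commute_iso])
  finally show ?thesis .
qed

end

section \<open>The homology of a point\<close>

lemma product_group_single:
  assumes "group G"
  shows "product_group {..<Suc 0} (\<lambda>_. G) \<cong> G"
proof -
  have "(\<lambda>f. f 0) \<in> iso (product_group {..<Suc 0} (\<lambda>_. G)) G"
  proof (rule iso_trivial_kernel)
    show "carrier G \<subseteq> (\<lambda>f. f 0) ` carrier (product_group {..<Suc 0} (\<lambda>_. G))"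
    proof
      fix x assume "x \<in> carrier G"
      then show "x \<in> (\<lambda>f. f 0) ` carrier (product_group {..<Suc 0} (\<lambda>_. G))"
        by (intro image_eqI[of _ _ "\<lambda>i\<in>{..<Suc 0}. x"]) auto
    qed
  qed (use assms in \<open>auto simp: hom_def PiE_iff extensional_def fun_eq_iff\<close>)
  then show ?thesis by (auto simp: is_iso_def)
qed

context
  fixes t :: 'a and a d :: int
begin

abbreviation (input) "T n \<equiv> frag_of (replicate (Suc n) t)"

lemma Cn_point_eq: "Cn {t} n = range (\<lambda>k. frag_cmul k (T n))"
proof (intro equalityI subsetI)
  fix c assume "c \<in> Cn {t} n"
  moreover have "tuples {t} n = {replicate (Suc n) t}"
    by (auto simp: tuples_def intro!: replicate_eqI simp del: replicate_Suc)
  ultimately have "Poly_Mapping.keys c \<subseteq> {replicate (Suc n) t}" by (simp add: Cn_def)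
  then show "c \<in> range (\<lambda>k. frag_cmul k (T n))"
  proof (induction c rule: frag_induction)
    case (diff x y)
    then show ?case by (auto simp flip: frag_cmul_diff_distrib)
  qed (auto intro: range_eqI[where x = 0] range_eqI[where x = 1])
qed (auto simp: tuples_def intro!: add_sub_cmul)

text \<open>The index \<open>n\<close> is the target degree. On constant tuples s_0 raises the
  degree and r is the identity in positive degree, so by \<open>bd_s_zero\<close> the coefficients
  in successive degrees add up to 1 for each idempotent operation.\<close>

lemma bd_point: "bd_ad a d (T (Suc n)) = frag_cmul (if odd n then a + d else 0) (T n)"
proof -
  have "bd_op f (T (Suc n)) = frag_cmul (if odd n then 1 else 0) (T n)" if f: "\<And>x. f x x = x" for f
  proof (induction n)
    case 0
    show ?case by (simp add: ops_frag_of bd_tuple_def f)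
  next
    case (Suc n)
    have "bd_op f (s_zero (T (Suc n))) + s_zero (bd_op f (T (Suc n))) = retr (T (Suc n))"
      by (rule bd_s_zero) (simp_all add: keys_frag_of f)
    then have "bd_op f (T (Suc (Suc n))) + s_zero (frag_cmul (if odd n then 1 else 0) (T n)) = T (Suc n)"
      unfolding Suc.IH by (simp add: ops_frag_of)
    then show ?case by (auto simp: ops_frag_of ops_linear split: if_splits)
  qed
  from this[of op_zero] this[of op_sim] show ?thesis
    by (simp add: bd_ad_def del: replicate_Suc flip: frag_cmul_distrib)
qed

lemma homology_point:
  shows "n = 0 \<or> even n \<and> a + d = 0 \<Longrightarrow> homology (C_cplx a d {t}) n \<cong> integer_group"
    and "odd n \<Longrightarrow> homology (C_cplx a d {t}) n \<cong> Zmod (a + d)"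
    and "n > 0 \<Longrightarrow> even n \<Longrightarrow> a + d \<noteq> 0 \<Longrightarrow> trivial_group (homology (C_cplx a d {t}) n)"
proof -
  let ?C = "C_cplx a d {t}"
  have bd: "bd_ad a d (frag_cmul k (T (Suc n))) = frag_cmul (k * (if odd n then a + d else 0)) (T n)" for k n
    by (simp add: bd_ad_lin bd_point del: replicate_Suc)
  have B: "boundaries ?C n = frag_cmul (if odd n then a + d else 0) ` Cn {t} n"
    by (simp add: boundaries_def C_cplx_eq Cn_point_eq image_image bd mult.commute del: replicate_Suc)
  have Z: "cycles ?C n = (if n > 0 \<and> even n \<and> a + d \<noteq> 0 then {0} else Cn {t} n)"
  proof (cases n)
    case (Suc m)
    then show ?thesis
      by (auto simp: cycles_Suc kernel_def C_cplx_eq Cn_point_eq bd_point bd_ad_lin simp del: replicate_Suc)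
  qed (simp add: cycles_0 C_cplx_eq)
  have H: "homology ?C n = add_grp (cycles ?C n) Mod boundaries ?C n"
    by (simp add: homology_def C_cplx_eq)
  \<comment> \<open>Multiplier 0 is allowed: it gives Z in degree 0 and, when a + d = 0, in all
    degrees.\<close>
  have iso: "add_grp (Cn {t} n) Mod (frag_cmul g ` Cn {t} n) \<cong> Zmod g" for g
    using iso_trans[OF Mod_cmul_iso product_group_single] free_rank_cyclic[of "T n"]
    by (simp add: Cn_point_eq del: replicate_Suc)
  show "homology ?C n \<cong> integer_group" if "n = 0 \<or> even n \<and> a + d = 0"
    using iso[of 0] that unfolding H B Z by (auto simp: Zmod_def integer_mod_group_def split: if_splits)
  show "homology ?C n \<cong> Zmod (a + d)" if "odd n"
    using iso[of "a + d"] that unfolding H B Z by auto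
  show "trivial_group (homology ?C n)" if "n > 0" "even n" "a + d \<noteq> 0"
  proof -
    have "group (homology ?C n)" by (intro group_homology chain_complex_C)
    moreover have "carrier (homology ?C n) = {\<one>\<^bsub>homology ?C n\<^esub>}"
      using that add_sub_closed(1)[OF add_sub_Cn, of "{t}" n]
      by (auto simp: H Z B carrier_FactGroup r_coset_def)
    ultimately show ?thesis by (simp add: trivial_group_def)
  qed
qed

end

section \<open>Trivial factors and closed forms of the exponents\<close>

lemma trivial_DirProd_iso:
  assumes "trivial_group G" "group H"
  shows "G \<times>\<times> H \<cong> H"
proof -
  have "snd \<in> iso (G \<times>\<times> H) H"
    using assms by (intro iso_trivial_kernel DirProd_group)
      (auto simp: trivial_group_def hom_def image_iff intro: group.is_monoid)
  then show ?thesis by (auto simp: is_iso_def)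
qed

lemma DirProd_trivial_iso:
  assumes "trivial_group G" "group H"
  shows "H \<times>\<times> G \<cong> H"
  using iso_trans[OF DirProd_commute_iso trivial_DirProd_iso[OF assms]] .

lemma group_Zmod_pow [simp]: "group (Zmod_pow g k)"
  by (simp add: Zmod_pow_def)

lemma trivial_Zmod_pow_0: "trivial_group (Zmod_pow g 0)"
  by (simp add: Zmod_pow_def trivial_product_group)

lemma u_alternating_sum: "u q n = (\<Sum>i\<le>n. (- 1) ^ (n - i) * int q ^ i)"
proof (induction n)
  case (Suc n)
  have "(\<Sum>i\<le>n. (- 1) ^ (Suc n - i) * int q ^ i) = (\<Sum>i\<le>n. - ((- 1) ^ (n - i) * int q ^ i))"
    by (intro sum.cong) (auto simp: Suc_diff_le)
  then show ?case using Suc by (simp add: sum_negf)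
qed simp

lemma u_rational: "(of_int (u q n) :: rat) = (of_nat q ^ (n + 1) + (- 1) ^ n) / (of_nat q + 1)"
proof -
  have "(of_nat q + 1) * (of_int (u q n) :: rat) = of_nat q ^ (n + 1) + (- 1) ^ n"
    using arg_cong[OF u_closed[of q n], of "of_int :: int \<Rightarrow> rat"] by simp
  moreover have "(of_nat q + 1 :: rat) \<noteq> 0" using of_nat_neq_0[of q] by (simp add: add.commute)
  ultimately show ?thesis by (simp add: field_simps)
qed

section \<open>Assembly of the five assertions\<close>

theorem theorem9p1:
  fixes X :: "'a set" and t :: 'a and a d :: int
  assumes "t \<in> X"
  shows
    "(chain_complex (C_cplx a d X) \<and> chain_complex (C_cplx a d {t}) \<and>
     chain_complex (F_red a d X t) \<and> chain_complex (CeN_red a d X t) \<and>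
     (\<exists>\<Phi>. splitting a d X t \<Phi>)) \<and>
     (a + d \<noteq> 0 \<longrightarrow>
       homology (C_cplx a d {t}) 0 \<cong> integer_group \<and>
       (\<forall>n. n > 0 \<and> even n \<longrightarrow> trivial_group (homology (C_cplx a d {t}) n)) \<and>
       (\<forall>n. odd n \<longrightarrow> homology (C_cplx a d {t}) n \<cong> Zmod (a + d))) \<and>
     (a + d = 0 \<longrightarrow> (\<forall>n. homology (C_cplx a d {t}) n \<cong> integer_group)) \<and>
     (finite X \<longrightarrow> a \<noteq> 0 \<or> d \<noteq> 0 \<longrightarrow>
       (\<forall>n. even n \<longrightarrow> homology (F_red a d X t) n \<cong> Zmod_pow (gcd a d) (u (card X) n - 1)) \<and>
       (\<forall>n. odd n \<longrightarrow> homology (F_red a d X t) n \<cong> Zmod_pow (gcd a d) (u (card X) n))) \<and>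
     (finite X \<longrightarrow>
       u (card X) 0 = 1 \<and> u (card X) 1 = int (card X) - 1 \<and>
       (\<forall>n\<ge>1. u (card X) n + u (card X) (n - 1) = int (card X) ^ n) \<and>
       (\<forall>n. u (card X) n = (\<Sum>i\<le>n. (- 1) ^ (n - i) * int (card X) ^ i)) \<and>
       (\<forall>n. (of_int (u (card X) n) :: rat) =
              (of_nat (card X) ^ (n + 1) + (- 1) ^ n) / (of_nat (card X) + 1))) \<and>
     (finite X \<longrightarrow> a \<noteq> 0 \<longrightarrow>
       (\<forall>n. homology (CeN_red a d X t) n \<cong>
              Zmod_pow a (u (card X) (n + 1) - u (card X) n + (- 1) ^ n))) \<and>
     (finite X \<longrightarrow> a \<noteq> 0 \<longrightarrow> a + d \<noteq> 0 \<longrightarrow>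
       homology (C_cplx a d X) 0 \<cong> integer_group \<times>\<times> Zmod_pow a (int (card X) - 1) \<and>
       (\<forall>n. n > 0 \<and> even n \<longrightarrow>
          homology (C_cplx a d X) n \<cong>
            Zmod_pow a (u (card X) (n + 1) - u (card X) n + 1) \<times>\<times>
            Zmod_pow (gcd a d) (u (card X) n - 1)) \<and>
       (\<forall>n. odd n \<longrightarrow>
          homology (C_cplx a d X) n \<cong>
            Zmod (a + d) \<times>\<times>
            (Zmod_pow a (u (card X) (n + 1) - u (card X) n - 1) \<times>\<times>
             Zmod_pow (gcd a d) (u (card X) n))))"
proof -
  interpret splitting_data X t a d by unfold_locales (rule assms)
  note C = chain_complex_C chain_complex_FR chain_complex_CN
  have F: "homology FR n \<cong> Zmod_pow (gcd a d) (if even n then u (card X) n - 1 else u (card X) n)"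
    if "finite X" "a \<noteq> 0 \<or> d \<noteq> 0" for n
    using iso_trans[OF homology_FR homology_K[OF that]] .
  have N: "homology CN n \<cong> Zmod_pow a (u (card X) (n + 1) - u (card X) n + (- 1) ^ n)"
    if "finite X" "a \<noteq> 0" for n
    using iso_trans[OF homology_CN homology_N[OF that]] .
  have sum: "homology CX n \<cong> homology CT n \<times>\<times>
      (Zmod_pow a (u (card X) (n + 1) - u (card X) n + (- 1) ^ n) \<times>\<times>
       Zmod_pow (gcd a d) (if even n then u (card X) n - 1 else u (card X) n))"
    if "finite X" "a \<noteq> 0" for n
    using that by (intro iso_trans[OF homology_CX] group.DirProd_iso_trans group_homology C iso_refl F N
        disjI1)
  have H0: "homology CX 0 \<cong> integer_group \<times>\<times> Zmod_pow a (int (card X) - 1)"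
    if "finite X" "a \<noteq> 0"
  proof -
    \<comment> \<open>Here u_1 - u_0 + 1 = |X| - 1 and u_0 - 1 = 0, so the factor from the
      degenerate part is trivial.\<close>
    have "homology CX 0 \<cong> homology CT 0 \<times>\<times> (Zmod_pow a (int (card X) - 1) \<times>\<times> Zmod_pow (gcd a d) 0)"
      using sum[OF that, of 0] by simp
    also have "\<dots> \<cong> integer_group \<times>\<times> Zmod_pow a (int (card X) - 1)"
      by (intro group.DirProd_iso_trans group_homology C homology_point(1) DirProd_trivial_iso
          trivial_Zmod_pow_0 group_Zmod_pow disjI1 refl)
    finally show ?thesis .
  qed
  \<comment> \<open>In positive even degree the point contributes a trivial factor, as a + d is
    nonzero.\<close>
  have Heven: "homology CX n \<cong> Zmod_pow a (u (card X) (n + 1) - u (card X) n + 1) \<times>\<times>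
      Zmod_pow (gcd a d) (u (card X) n - 1)"
    if "finite X" "a \<noteq> 0" "a + d \<noteq> 0" "n > 0 \<and> even n" for n
    using that sum[OF that(1,2), of n]
      iso_trans[OF sum[OF that(1,2), of n] trivial_DirProd_iso[OF homology_point(3)[of n a d t]]]
    by (simp add: DirProd_group)
  have Hodd: "homology CX n \<cong> Zmod (a + d) \<times>\<times>
      (Zmod_pow a (u (card X) (n + 1) - u (card X) n - 1) \<times>\<times> Zmod_pow (gcd a d) (u (card X) n))"
    if "finite X" "a \<noteq> 0" "odd n" for n
  proof -
    have "homology CX n \<cong> homology CT n \<times>\<times>
        (Zmod_pow a (u (card X) (n + 1) - u (card X) n - 1) \<times>\<times> Zmod_pow (gcd a d) (u (card X) n))"
      using sum[OF that(1,2), of n] that(3) by simp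
    also have "\<dots> \<cong> Zmod (a + d) \<times>\<times>
        (Zmod_pow a (u (card X) (n + 1) - u (card X) n - 1) \<times>\<times> Zmod_pow (gcd a d) (u (card X) n))"
      by (intro group.DirProd_iso_trans group_homology C homology_point(2) iso_refl that)
    finally show ?thesis .
  qed
  have u_step: "u (card X) n + u (card X) (n - 1) = int (card X) ^ n" if "n \<ge> 1" for n
    using that by (cases n) auto
  show ?thesis
  proof (intro conjI impI allI)
    show "\<exists>\<Phi>. splitting a d X t \<Phi>" by (rule exI[of _ \<Phi>], rule splitting_\<Phi>)
    show "homology CT 0 \<cong> integer_group" by (rule homology_point(1)) simp
    show "trivial_group (homology CT n)" if "a + d \<noteq> 0" "n > 0 \<and> even n" for n
      using that by (intro homology_point(3)) auto
    show "homology CT n \<cong> Zmod (a + d)" if "odd n" for n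
      using that by (rule homology_point(2))
    \<comment> \<open>For odd n the group is \<open>Zmod 0\<close>, which is Z.\<close>
    show "homology CT n \<cong> integer_group" if "a + d = 0" for n
      using that homology_point(1,2)[of n a d t] by (cases "even n") (simp_all add: Zmod_def integer_mod_group_def)
    show "homology FR n \<cong> Zmod_pow (gcd a d) (u (card X) n - 1)"
      if "finite X" "a \<noteq> 0 \<or> d \<noteq> 0" "even n" for n
      using F[OF that(1,2), of n] that(3) by simp
    show "homology FR n \<cong> Zmod_pow (gcd a d) (u (card X) n)"
      if "finite X" "a \<noteq> 0 \<or> d \<noteq> 0" "odd n" for n
      using F[OF that(1,2), of n] that(3) by simp
    show "u (card X) 0 = 1" "u (card X) 1 = int (card X) - 1" by simp_all
  qed (assumption | rule C u_step u_alternating_sum u_rational N H0 Heven Hodd)+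
qed

end
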